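(* There exists a separable metrizable topological group that is countable dense homogeneous and is not Polish.
   Context: The result is a theorem of ZFC. A space $X$ is countable dense homogeneous if for every pair $(D,E)$ of countable (i.e., at most countable) dense subsets of $X$ there exists a homeomorphism $h:X\to X$ such that $h[D]=E$. A space is Polish if it is separable and completely metrizable (i.e., its topology is induced by some complete metric). *)

theory Defs
  imports "HOL-Analysis.Analysis" "HOL-Algebra.Group"
begin

definition topological_group :: "('a, 'b) monoid_scheme \<Rightarrow> 'a topology \<Rightarrow> bool"
  where "topological_group G T \<longleftrightarrow>
    group G \<and>
    topspace T = carrier G \<and>
    continuous_map (prod_topology T T) T (\<lambda>(x, y). x \<otimes>\<^bsub>G\<^esub> y) \<and>
    continuous_map T T (\<lambda>x. inv\<^bsub>G\<^esub> x)"

definition dense_subset :: "'a topology \<Rightarrow> 'a set \<Rightarrow> bool"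
  where "dense_subset X D \<longleftrightarrow> D \<subseteq> topspace X \<and> X closure_of D = topspace X"

definition countable_dense_homogeneous :: "'a topology \<Rightarrow> bool"
  where "countable_dense_homogeneous X \<longleftrightarrow>
    (\<forall>D E. countable D \<and> dense_subset X D \<and> countable E \<and> dense_subset X E \<longrightarrow>
      (\<exists>h. homeomorphic_map X X h \<and> h ` D = E))"

text \<open>The library's type class \<open>polish_space\<close> speaks about whole types; this is the corresponding
  notion for abstract topologies.\<close>

definition Polish_space :: "'a topology \<Rightarrow> bool"
  where "Polish_space X \<longleftrightarrow> separable_space X \<and> completely_metrizable_space X"

text \<open>HOL has no quantifier over types, so an existence claim about topological groups has to fix
  the type of the points. The type \<open>nat \<Rightarrow> real\<close> is no restriction for separable metrizable groups:
  such a group has at most continuum many elements (every separable metrizable space even embeds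
  in the countable power of the real line), so it has an isomorphic and homeomorphic copy whose
  carrier is a subset of \<open>nat \<Rightarrow> real\<close>. Neither the group operation nor the topology of that copy
  need be related to those of the ambient type.\<close>

end

theory Submission
  imports Defs "HOL-Library.Countable_Set_Type"
begin

text \<open>The group consists of all integer arrays with finitely many non-zero rows whose rows lie in a
fixed group \<open>H\<close> of integer sequences; two arrays are close if they agree on a long initial segment
of coordinates. The group \<open>H\<close> is spanned by a chain of length \<open>\<omega>\<^sub>1\<close> of functions from \<open>nat\<close> to
\<open>nat\<close>, each of which eventually exceeds every multiple of the earlier ones. Two features of this
group matter.

First, every countable subset \<open>D\<close> is a relative \<open>G\<^sub>\<delta>\<close>. An integer combination of chain members grows like
its leading term. Hence a combination \<open>h\<close> lies outside the span of the members below \<open>a\<close> exactly if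
\<open>2 * \<bar>h k\<bar> \<ge> a k\<close> for all large \<open>k\<close> (\<open>eventually_large\<close>, \<open>not_eventually_large\<close>), and this is an
\<open>F\<^sub>\<sigma>\<close> condition. The set \<open>D\<close> uses only countably many members of the chain, so it is contained in the
countable group of arrays built from the members below some \<open>a\<close>; the complement of \<open>D\<close> is the
\<open>F\<^sub>\<sigma>\<close> set of the remaining arrays together with countably many points (\<open>arrays_co_F_sigma\<close>). By
the Baire category theorem a non-empty Polish space without isolated points has no countable dense
\<open>G\<^sub>\<delta>\<close> subset, so the group is not Polish.

Second, every non-empty open set \<open>V\<close> contains a closed copy of the whole space that avoids a
prescribed countable set \<open>E\<close> (\<open>arrays_absorb\<close>): freeze the first rows so as to stay inside \<open>V\<close>, let the
next row be an element of the uncountable group \<open>H\<close> that is not the corresponding row of any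
element of \<open>E\<close>, and write the given array into the rows after it.

These two properties imply countable dense homogeneity. Let \<open>D\<close> and \<open>E\<close> be countable and dense. The
space is covered by countably many closed sets, each of them disjoint from \<open>D\<close> or a singleton in \<open>D\<close>,
and likewise for \<open>E\<close>. The homeomorphism is the intersection of a decreasing sequence of relations.
Each relation consists of pairs at which the relation already behaves like a homeomorphism, and
of boxes \<open>U \<times> V\<close> of open sets in which nothing has been decided. To deal with a closed set \<open>A\<close>
disjoint from \<open>D\<close>, embed \<open>A \<inter> U\<close> into \<open>V - E\<close> for each box; a construction in the manner of Knaster and Reichbach
(\<open>knaster_reichbach\<close>) splits the complements of \<open>A \<inter> U\<close> and of its image into smaller boxes that
shrink towards corresponding points. A point of \<open>D\<close> is treated in the same way, with a point of
\<open>E\<close> in \<open>V\<close> as its image. Doing this alternately on both sides for all sets of the two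
covers, every point is settled after finitely many steps, so that no limit argument is required
beyond taking the intersection.\<close>

section \<open>Sequence spaces with the topology of initial segments\<close>

definition agree :: "nat \<Rightarrow> (nat \<Rightarrow> 'b) \<Rightarrow> (nat \<Rightarrow> 'b) \<Rightarrow> bool"
  where "agree n x y \<longleftrightarrow> (\<forall>i<n. x i = y i)"

definition cyl_topology :: "(nat \<Rightarrow> 'b) set \<Rightarrow> (nat \<Rightarrow> 'b) topology"
  where "cyl_topology X = subtopology (product_topology (\<lambda>_. discrete_topology UNIV) UNIV) X"

lemma agree_refl [simp]: "agree n x x"
  by (simp add: agree_def)

lemma agree_sym: "agree n x y \<Longrightarrow> agree n y x"
  by (simp add: agree_def)

lemma agree_trans: "agree n x y \<Longrightarrow> agree n y z \<Longrightarrow> agree n x z"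
  by (simp add: agree_def)

lemma agree_mono: "agree n x y \<Longrightarrow> m \<le> n \<Longrightarrow> agree m x y"
  by (simp add: agree_def)

lemma agree_eqI: "(\<And>n. agree n x y) \<Longrightarrow> x = y"
  unfolding agree_def by blast

lemma agree_iff_map: "agree n x y \<longleftrightarrow> map x [0..<n] = map y [0..<n]"
  by (auto simp: agree_def)

lemma topspace_cyl_topology [simp]: "topspace (cyl_topology X) = X"
  by (simp add: cyl_topology_def)

lemma openin_product_cylinder:
  "openin (product_topology (\<lambda>_. discrete_topology UNIV) UNIV) {y. agree n x y}"
proof -
  have "openin (product_topology (\<lambda>_. discrete_topology UNIV) (UNIV::nat set))
      (Pi\<^sub>E UNIV (\<lambda>i. if i < n then {x i} else UNIV))"
  proof (rule product_topology_basis)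
    have "{i. (if i < n then {x i} else UNIV) \<noteq> topspace (discrete_topology UNIV)} \<subseteq> {..<n}"
      by auto
    then show "finite {i. (if i < n then {x i} else UNIV) \<noteq> topspace (discrete_topology UNIV)}"
      using finite_subset by blast
  qed auto
  moreover have "Pi\<^sub>E UNIV (\<lambda>i. if i < n then {x i} else UNIV) = {y. agree n x y}"
    by (auto simp: PiE_UNIV_domain Pi_iff agree_def split: if_splits)
  ultimately show ?thesis by simp
qed

lemma openin_product_discrete_iff:
  "openin (product_topology (\<lambda>_. discrete_topology UNIV) UNIV) U \<longleftrightarrow>
    (\<forall>x\<in>U. \<exists>n. \<forall>y. agree n x y \<longrightarrow> y \<in> U)" (is "?L \<longleftrightarrow> ?R")
proof
  assume L: ?L
  show ?R
  proof
    fix x assume "x \<in> U"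
    from product_topology_open_contains_basis[OF L this] obtain W where
      W: "x \<in> Pi\<^sub>E UNIV W" "finite {i. W i \<noteq> topspace (discrete_topology UNIV)}" "Pi\<^sub>E UNIV W \<subseteq> U"
      by auto
    from W(2) obtain n where n: "\<And>i. W i \<noteq> UNIV \<Longrightarrow> i < n"
      using finite_nat_set_iff_bounded by auto
    have "y \<in> U" if "agree n x y" for y
    proof -
      have "y i \<in> W i" for i
      proof (cases "W i = UNIV")
        case False
        then have "y i = x i" using n that by (simp add: agree_def)
        then show ?thesis using W(1) by (simp add: PiE_UNIV_domain Pi_iff)
      qed simp
      then show ?thesis using W(3) by (auto simp: PiE_UNIV_domain Pi_iff)
    qed
    then show "\<exists>n. \<forall>y. agree n x y \<longrightarrow> y \<in> U" by blast
  qed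
next
  assume R: ?R
  show ?L
  proof (subst openin_subopen, intro ballI)
    fix x assume "x \<in> U"
    with R obtain n where "\<forall>y. agree n x y \<longrightarrow> y \<in> U" by blast
    then show "\<exists>T. openin (product_topology (\<lambda>_. discrete_topology UNIV) UNIV) T \<and> x \<in> T \<and> T \<subseteq> U"
      using openin_product_cylinder[of n x] by (intro exI[of _ "{y. agree n x y}"]) auto
  qed
qed

text \<open>All later topological arguments go through this description and its dual for closed sets; the
product topology itself only serves to import metrizability from the library.\<close>

lemma openin_cyl_topology:
  "openin (cyl_topology X) U \<longleftrightarrow> U \<subseteq> X \<and> (\<forall>x\<in>U. \<exists>n. \<forall>y\<in>X. agree n x y \<longrightarrow> y \<in> U)" (is "?L \<longleftrightarrow> ?R")
proof
  assume ?L
  then show ?R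
    unfolding cyl_topology_def openin_subtopology openin_product_discrete_iff by blast
next
  assume R: ?R
  define W where "W = {z. \<exists>x\<in>U. \<exists>n. agree n x z \<and> (\<forall>y\<in>X. agree n x y \<longrightarrow> y \<in> U)}"
  have "openin (product_topology (\<lambda>_. discrete_topology UNIV) UNIV) W"
    unfolding openin_product_discrete_iff W_def by (auto intro: agree_trans)
  moreover have "U = W \<inter> X"
  proof
    show "U \<subseteq> W \<inter> X"
    proof
      fix x assume "x \<in> U"
      moreover from this R obtain n where "\<forall>y\<in>X. agree n x y \<longrightarrow> y \<in> U" by blast
      ultimately show "x \<in> W \<inter> X" using R agree_refl[of n x] unfolding W_def by blast
    qed
  qed (auto simp: W_def)
  ultimately show ?L
    unfolding cyl_topology_def openin_subtopology by blast
qed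

lemma closedin_cyl_topology:
  "closedin (cyl_topology X) C \<longleftrightarrow>
    C \<subseteq> X \<and> (\<forall>x\<in>X. (\<forall>n. \<exists>y\<in>C. agree n x y) \<longrightarrow> x \<in> C)"
  unfolding closedin_def openin_cyl_topology topspace_cyl_topology by blast

lemma closedin_singleton:
  assumes "x \<in> X"
  shows "closedin (cyl_topology X) {x}"
  unfolding closedin_cyl_topology
proof (intro conjI ballI impI)
  fix z assume "\<forall>n. \<exists>y\<in>{x}. agree n z y"
  then have "z = x" by (intro agree_eqI) simp
  then show "z \<in> {x}" by simp
qed (use assms in simp)

lemma openin_cylinder: "openin (cyl_topology X) {y\<in>X. agree n x y}"
  unfolding openin_cyl_topology by (auto intro: agree_trans)

lemma dense_subset_cyl_topology:
  "dense_subset (cyl_topology X) D \<longleftrightarrow> D \<subseteq> X \<and> (\<forall>x\<in>X. \<forall>n. \<exists>d\<in>D. agree n x d)"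
proof -
  have "x \<in> cyl_topology X closure_of D \<longleftrightarrow> (\<forall>n. \<exists>d\<in>D. agree n x d)" if "x \<in> X" "D \<subseteq> X" for x
  proof
    assume L: "x \<in> cyl_topology X closure_of D"
    show "\<forall>n. \<exists>d\<in>D. agree n x d"
    proof
      fix n
      have "x \<in> {y\<in>X. agree n x y}" using that by simp
      with L openin_cylinder[of X n x] obtain d where "d \<in> D" "d \<in> {y\<in>X. agree n x y}"
        unfolding in_closure_of by meson
      then show "\<exists>d\<in>D. agree n x d" by blast
    qed
  next
    assume R: "\<forall>n. \<exists>d\<in>D. agree n x d"
    have "\<exists>y\<in>D. y \<in> T" if T: "x \<in> T" "openin (cyl_topology X) T" for T
    proof -
      obtain n where "\<forall>y\<in>X. agree n x y \<longrightarrow> y \<in> T"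
        using T unfolding openin_cyl_topology by blast
      then show ?thesis using R \<open>D \<subseteq> X\<close> by blast
    qed
    then show "x \<in> cyl_topology X closure_of D"
      unfolding in_closure_of using \<open>x \<in> X\<close> by auto
  qed
  moreover have "cyl_topology X closure_of D \<subseteq> X"
    using closure_of_subset_topspace[of "cyl_topology X"] by simp
  ultimately show ?thesis
    unfolding dense_subset_def topspace_cyl_topology by blast
qed

lemma metrizable_space_cyl_topology: "metrizable_space (cyl_topology X)"
  unfolding cyl_topology_def
  by (rule metrizable_space_subtopology) (simp add: metrizable_space_product_topology)

lemma countable_prefixes:
  assumes "countable C" "\<And>x i. x \<in> X \<Longrightarrow> x i \<in> C"
  shows "countable {map x [0..<n] | x n. x \<in> X}"
proof -
  have "{map x [0..<n] | x n. x \<in> X} \<subseteq> lists C"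
    using assms(2) by auto
  then show ?thesis using assms(1) countable_lists countable_subset by blast
qed

lemma countable_dense_cyl_topology:
  assumes "countable C" "\<And>x i. x \<in> X \<Longrightarrow> x i \<in> C"
  shows "\<exists>D. countable D \<and> dense_subset (cyl_topology X) D"
proof -
  define P where "P = {map x [0..<n] | x n. x \<in> X}"
  define pick where "pick s = (SOME x. x \<in> X \<and> map x [0..<length s] = s)" for s
  have pick: "pick s \<in> X \<and> map (pick s) [0..<length s] = s" if s: "s \<in> P" for s
  proof -
    obtain x n where "x \<in> X" "s = map x [0..<n]" using s P_def by blast
    then have "x \<in> X \<and> map x [0..<length s] = s" by simp
    then show ?thesis unfolding pick_def by (rule someI[where P = "\<lambda>x. x \<in> X \<and> map x [0..<length s] = s"])
  qed
  have "countable (pick ` P)" unfolding P_def using countable_prefixes[of C X] assms by auto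
  moreover have "\<exists>d\<in>pick ` P. agree n x d" if "x \<in> X" for x n
  proof -
    have "map x [0..<n] \<in> P" using that P_def by blast
    moreover from pick[OF this] have "agree n x (pick (map x [0..<n]))"
      by (simp add: agree_iff_map)
    ultimately show ?thesis by blast
  qed
  ultimately show ?thesis
    unfolding dense_subset_cyl_topology using pick by blast
qed

section \<open>Relations approximating a homeomorphism\<close>

text \<open>Upper semicontinuity of the set-valued map \<open>S\<close> at \<open>x\<close> with limit \<open>y\<close>. Since \<open>u = x\<close> is allowed, it
forces \<open>y\<close> to be the only possible value at \<open>x\<close>, and it is inherited by every smaller relation. These
two facts make the intersection of the approximations a continuous function.\<close>

definition usc :: "((nat \<Rightarrow> 'b) \<times> (nat \<Rightarrow> 'b)) set \<Rightarrow> (nat \<Rightarrow> 'b) \<Rightarrow> (nat \<Rightarrow> 'b) \<Rightarrow> bool"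
  where "usc S x y \<longleftrightarrow> (\<forall>m. \<exists>k. \<forall>u v. (u, v) \<in> S \<longrightarrow> agree k x u \<longrightarrow> agree m y v)"

definition settled :: "((nat \<Rightarrow> 'b) \<times> (nat \<Rightarrow> 'b)) set \<Rightarrow> (nat \<Rightarrow> 'b) \<Rightarrow> (nat \<Rightarrow> 'b) \<Rightarrow> bool"
  where "settled S x y \<longleftrightarrow> usc S x y \<and> usc (S\<inverse>) y x"

text \<open>No point outside \<open>U\<close> is related to a point of \<open>V\<close> and vice versa, so the part of \<open>S\<close> inside
the box can be replaced by any other relation between \<open>U\<close> and \<open>V\<close> without affecting the rest.\<close>

definition boxed ::
  "(nat \<Rightarrow> 'b) set \<Rightarrow> ((nat \<Rightarrow> 'b) \<times> (nat \<Rightarrow> 'b)) set \<Rightarrow> (nat \<Rightarrow> 'b) \<Rightarrow> (nat \<Rightarrow> 'b) \<Rightarrow> bool"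
  where "boxed X S x y \<longleftrightarrow> (\<exists>U V. x \<in> U \<and> y \<in> V \<and>
    openin (cyl_topology X) U \<and> openin (cyl_topology X) V \<and>
    U \<times> V \<subseteq> S \<and> (\<forall>(u, v)\<in>S. u \<in> U \<longleftrightarrow> v \<in> V))"

text \<open>An approximation to a homeomorphism from \<open>U\<close> onto \<open>V\<close> that carries \<open>D\<close> to \<open>E\<close>. Both totality
conditions survive to the intersection only because every point is eventually settled.\<close>

definition partial_match ::
  "(nat \<Rightarrow> 'b) set \<Rightarrow> (nat \<Rightarrow> 'b) set \<Rightarrow> (nat \<Rightarrow> 'b) set \<Rightarrow> (nat \<Rightarrow> 'b) set \<Rightarrow> (nat \<Rightarrow> 'b) set \<Rightarrow>
    ((nat \<Rightarrow> 'b) \<times> (nat \<Rightarrow> 'b)) set \<Rightarrow> bool"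
  where "partial_match X D E U V S \<longleftrightarrow>
    S \<subseteq> U \<times> V \<and> Domain S = U \<and> Range S = V \<and>
    (\<forall>(x, y)\<in>S. settled S x y \<and> (x \<in> D \<longleftrightarrow> y \<in> E) \<or> boxed X S x y)"

lemma usc_mono:
  assumes "usc S x y" "S' \<subseteq> S"
  shows "usc S' x y"
  unfolding usc_def
proof
  fix m
  from assms(1) obtain k where "\<forall>u v. (u, v) \<in> S \<longrightarrow> agree k x u \<longrightarrow> agree m y v"
    unfolding usc_def by blast
  with assms(2) show "\<exists>k. \<forall>u v. (u, v) \<in> S' \<longrightarrow> agree k x u \<longrightarrow> agree m y v"
    by (intro exI[of _ k]) auto
qed

lemma settled_mono: "settled S x y \<Longrightarrow> S' \<subseteq> S \<Longrightarrow> settled S' x y"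
  unfolding settled_def using usc_mono by blast

lemma settled_converse: "settled (S\<inverse>) y x \<longleftrightarrow> settled S x y"
  unfolding settled_def by auto

lemma usc_unique: "usc S x y \<Longrightarrow> (x, v) \<in> S \<Longrightarrow> v = y"
  unfolding usc_def using agree_eqI agree_refl by metis

lemma settled_unique: "settled S x y \<Longrightarrow> (x, v) \<in> S \<Longrightarrow> v = y"
  unfolding settled_def using usc_unique by blast

lemma boxed_converse: "boxed X (S\<inverse>) y x \<longleftrightarrow> boxed X S x y"
proof -
  have "boxed X (S\<inverse>) y x" if "boxed X S x y" for S and x y :: "nat \<Rightarrow> 'a"
  proof -
    from that obtain U V where "x \<in> U" "y \<in> V" "openin (cyl_topology X) U"
      "openin (cyl_topology X) V" "U \<times> V \<subseteq> S" "\<forall>(u, v)\<in>S. u \<in> U \<longleftrightarrow> v \<in> V"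
      unfolding boxed_def by blast
    then show ?thesis
      unfolding boxed_def by (intro exI[of _ V] exI[of _ U]) auto
  qed
  from this[of S x y] this[of "S\<inverse>" y x] show ?thesis by auto
qed

lemma partial_match_converse:
  "partial_match X D E U V S \<Longrightarrow> partial_match X E D V U (S\<inverse>)"
  unfolding partial_match_def by (auto simp: settled_converse boxed_converse)

lemma usc_local:
  assumes "usc S x y" "openin (cyl_topology X) U" "x \<in> U" "Domain S' \<subseteq> X"
    and "\<And>u v. u \<in> U \<Longrightarrow> (u, v) \<in> S' \<Longrightarrow> (u, v) \<in> S"
  shows "usc S' x y"
  unfolding usc_def
proof
  fix m
  obtain k where k: "\<forall>u v. (u, v) \<in> S \<longrightarrow> agree k x u \<longrightarrow> agree m y v"
    using assms(1) unfolding usc_def by blast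
  obtain n where n: "\<forall>u\<in>X. agree n x u \<longrightarrow> u \<in> U"
    using assms(2,3) unfolding openin_cyl_topology by blast
  have "agree m y v" if "(u, v) \<in> S'" "agree (max k n) x u" for u v
  proof -
    have "u \<in> X" using that(1) assms(4) by blast
    moreover have "agree k x u" "agree n x u" using that(2) by (auto intro: agree_mono)
    ultimately have "(u, v) \<in> S" using n assms(5) that(1) by simp
    then show ?thesis using k \<open>agree k x u\<close> by simp
  qed
  then show "\<exists>k. \<forall>u v. (u, v) \<in> S' \<longrightarrow> agree k x u \<longrightarrow> agree m y v" by blast
qed

text \<open>Being settled depends only on the pairs near \<open>x\<close> and near \<open>y\<close>, so it can be checked inside a box.\<close>

lemma settled_local:
  assumes "settled S x y" "openin (cyl_topology X) U" "openin (cyl_topology X) V" "x \<in> U" "y \<in> V"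
    and "S' \<subseteq> X \<times> X"
    and "\<And>u v. (u, v) \<in> S' \<Longrightarrow> u \<in> U \<or> v \<in> V \<Longrightarrow> (u, v) \<in> S"
  shows "settled S' x y"
proof -
  have S: "usc S x y" "usc (S\<inverse>) y x" using assms(1) unfolding settled_def by auto
  have D: "Domain S' \<subseteq> X" "Domain (S'\<inverse>) \<subseteq> X" using assms(6) by auto
  have "usc S' x y"
    by (rule usc_local[OF S(1) assms(2,4) D(1)]) (use assms(7) in blast)
  moreover have "usc (S'\<inverse>) y x"
    by (rule usc_local[OF S(2) assms(3,5) D(2)]) (use assms(7) in blast)
  ultimately show ?thesis by (simp add: settled_def)
qed

text \<open>Boxes are clopen. A point \<open>x'\<close> in the closure of \<open>U\<close> cannot be settled with a value outside \<open>V\<close>, since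
every fixed \<open>y \<in> V\<close> is related to points arbitrarily close to \<open>x'\<close>; and if \<open>x'\<close> lies in another box, then
that box meets \<open>U\<close> and hence captures \<open>x'\<close> for \<open>U\<close>. Closedness is needed to intersect a closed set with \<open>U\<close>
and still have a closed set.\<close>

lemma box_closed:
  assumes S: "partial_match X D E X X S"
    and UV: "openin (cyl_topology X) U" "y \<in> V" "U \<times> V \<subseteq> S" "\<forall>(u, v)\<in>S. u \<in> U \<longleftrightarrow> v \<in> V"
  shows "closedin (cyl_topology X) U"
  unfolding closedin_cyl_topology
proof (intro conjI ballI impI)
  show "U \<subseteq> X" using UV(1) by (simp add: openin_cyl_topology)
  fix x' assume x': "x' \<in> X" and lim: "\<forall>n. \<exists>u\<in>U. agree n x' u"
  obtain y' where xy': "(x', y') \<in> S" using S x' unfolding partial_match_def by blast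
  show "x' \<in> U"
  proof (rule ccontr)
    assume nU: "x' \<notin> U"
    then have "y' \<notin> V" using xy' UV(4) by blast
    then have "y' \<noteq> y" using UV(2) by blast
    then obtain m where m: "\<not> agree m y' y" using agree_eqI by blast
    have "settled S x' y' \<or> boxed X S x' y'"
      using S xy' unfolding partial_match_def by blast
    then show False
    proof
      assume "settled S x' y'"
      then obtain k where k: "\<forall>u v. (u, v) \<in> S \<longrightarrow> agree k x' u \<longrightarrow> agree m y' v"
        unfolding settled_def usc_def by blast
      from lim obtain u where "u \<in> U" "agree k x' u" by blast
      with k UV(2,3) m show False by blast
    next
      assume "boxed X S x' y'"
      then obtain U' V' where B: "x' \<in> U'" "y' \<in> V'" "openin (cyl_topology X) U'" "U' \<times> V' \<subseteq> S"
        "\<forall>(u, v)\<in>S. u \<in> U' \<longleftrightarrow> v \<in> V'" unfolding boxed_def by blast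
      obtain n where n: "\<forall>u\<in>X. agree n x' u \<longrightarrow> u \<in> U'"
        using B(1,3) unfolding openin_cyl_topology by blast
      from lim obtain u where "u \<in> U" "agree n x' u" by blast
      with n \<open>U \<subseteq> X\<close> have "u \<in> U'" by blast
      have "(u, y) \<in> S" using \<open>u \<in> U\<close> UV by blast
      then have "y \<in> V'" using B(5) \<open>u \<in> U'\<close> by blast
      then have "(x', y) \<in> S" using B by blast
      then show False using UV(2,4) nU by blast
    qed
  qed
qed

section \<open>Extending a homeomorphism between closed nowhere dense sets\<close>

text \<open>The length of the longest initial segment that \<open>u\<close> shares with a member of \<open>F\<close>; it measures how
close \<open>u\<close> is to \<open>F\<close>. Points with the same shared segment (the same \<open>key\<close>) form one piece of the
complement of \<open>F\<close>. Grouping by the shared segment, and not by the first segment that leaves \<open>F\<close>, is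
essential: in the absence of compactness a segment may be left in infinitely many ways, and the
resulting pieces would not converge to \<open>F\<close>.\<close>

definition lev :: "(nat \<Rightarrow> 'b) set \<Rightarrow> (nat \<Rightarrow> 'b) \<Rightarrow> nat"
  where "lev F u = (GREATEST n. \<exists>p\<in>F. agree n u p)"

definition key :: "(nat \<Rightarrow> 'b) set \<Rightarrow> (nat \<Rightarrow> 'b) \<Rightarrow> 'b list"
  where "key F u = map u [0..<lev F u]"

text \<open>A point of \<open>F\<close> next to the piece labelled by \<open>s\<close>.\<close>

definition rep :: "(nat \<Rightarrow> 'b) set \<Rightarrow> 'b list \<Rightarrow> (nat \<Rightarrow> 'b)"
  where "rep F s = (SOME p. p \<in> F \<and> map p [0..<length s] = s)"

lemma length_key [simp]: "length (key F u) = lev F u"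
  by (simp add: key_def)

lemma key_eq_agree: "key F u = key F v \<Longrightarrow> agree (lev F u) u v"
  unfolding agree_iff_map by (metis key_def length_key)

lemma
  assumes "closedin (cyl_topology X) F" "F \<noteq> {}" "u \<in> X" "u \<notin> F"
  shows lev_attained: "\<exists>p\<in>F. agree (lev F u) u p"
    and lev_upper: "\<And>n p. p \<in> F \<Longrightarrow> agree n u p \<Longrightarrow> n \<le> lev F u"
proof -
  obtain N where N: "\<not> (\<exists>p\<in>F. agree N u p)"
    using assms unfolding closedin_cyl_topology by blast
  have bound: "n \<le> N" if "\<exists>p\<in>F. agree n u p" for n
    using that N agree_mono by (meson nat_le_linear)
  obtain p where "p \<in> F" using assms(2) by blast
  then have zero: "\<exists>p\<in>F. agree 0 u p" by (auto simp: agree_def)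
  show "\<exists>p\<in>F. agree (lev F u) u p"
    unfolding lev_def by (rule GreatestI_nat[where P = "\<lambda>n. \<exists>p\<in>F. agree n u p", OF zero bound])
  show "n \<le> lev F u" if "p \<in> F" "agree n u p" for n p
    unfolding lev_def
    by (rule Greatest_le_nat[where P = "\<lambda>n. \<exists>p\<in>F. agree n u p", OF _ bound]) (use that in auto)
qed

lemma
  assumes "closedin (cyl_topology X) F" "F \<noteq> {}" "u \<in> X" "u \<notin> F"
  shows rep_key_in: "rep F (key F u) \<in> F"
    and rep_key_agree: "agree (lev F u) u (rep F (key F u))"
proof -
  obtain p where "p \<in> F" "agree (lev F u) u p" using lev_attained[OF assms] by blast
  then have "p \<in> F \<and> map p [0..<length (key F u)] = key F u"
    unfolding length_key by (simp add: key_def agree_iff_map)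
  then have "rep F (key F u) \<in> F \<and> map (rep F (key F u)) [0..<length (key F u)] = key F u"
    unfolding rep_def by (rule someI[where P = "\<lambda>p. p \<in> F \<and> map p [0..<length (key F u)] = key F u"])
  then show "rep F (key F u) \<in> F" "agree (lev F u) u (rep F (key F u))"
    unfolding length_key by (simp_all add: agree_iff_map) (simp add: key_def)
qed

lemma key_locally_constant:
  assumes F: "closedin (cyl_topology X) F" "F \<noteq> {}" and u: "u \<in> X" "u \<notin> F"
    and v: "v \<in> X" "agree (Suc (lev F u)) u v"
  shows "v \<notin> F" "key F v = key F u"
proof -
  show vF: "v \<notin> F" using lev_upper[OF F u, of v "Suc (lev F u)"] v by auto
  have uv: "agree (lev F u) v u" using v(2) agree_mono agree_sym by (metis le_SucI order_refl)
  obtain p where "p \<in> F" "agree (lev F u) u p" using lev_attained[OF F u] by blast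
  then have "lev F u \<le> lev F v" using lev_upper[OF F v(1) vF] uv agree_trans by blast
  moreover have "\<not> Suc (lev F u) \<le> lev F v"
  proof
    assume *: "Suc (lev F u) \<le> lev F v"
    obtain p where p: "p \<in> F" "agree (lev F v) v p" using lev_attained[OF F v(1) vF] by blast
    then have "agree (Suc (lev F u)) u p" using v(2) * agree_mono agree_trans by blast
    with p(1) lev_upper[OF F u] show False by fastforce
  qed
  ultimately have "lev F v = lev F u" by simp
  then show "key F v = key F u" using uv by (simp add: key_def agree_iff_map)
qed

lemma openin_keys:
  assumes F: "closedin (cyl_topology X) F" "F \<noteq> {}" and U: "openin (cyl_topology X) U"
  shows "openin (cyl_topology X) {u \<in> U - F. Q (key F u)}"
  unfolding openin_cyl_topology
proof (intro conjI ballI)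
  have UX: "U \<subseteq> X" using U by (simp add: openin_cyl_topology)
  then show "{u \<in> U - F. Q (key F u)} \<subseteq> X" by blast
  fix u assume u: "u \<in> {u \<in> U - F. Q (key F u)}"
  then obtain n where n: "\<forall>v\<in>X. agree n u v \<longrightarrow> v \<in> U"
    using U unfolding openin_cyl_topology by blast
  have "v \<in> {u \<in> U - F. Q (key F u)}" if v: "v \<in> X" "agree (max n (Suc (lev F u))) u v" for v
  proof -
    have a: "agree n u v" "agree (Suc (lev F u)) u v"
      by (rule agree_mono[OF v(2)], simp)+
    have "u \<in> X" "u \<notin> F" using u UX by auto
    from key_locally_constant[OF F this v(1) a(2)] a(1) n v(1) u show ?thesis by auto
  qed
  then show "\<exists>n. \<forall>v\<in>X. agree n u v \<longrightarrow> v \<in> {u \<in> U - F. Q (key F u)}" by blast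
qed

text \<open>Because \<open>G\<close> is nowhere dense, each of its points is a limit of whole pieces of the complement.\<close>

lemma keys_near:
  assumes G: "closedin (cyl_topology X) G" "q \<in> G"
    and V: "openin (cyl_topology X) V" "G \<subseteq> V"
    and nd: "\<forall>n. \<exists>v\<in>X - G. agree n q v"
  shows "\<exists>v\<in>V - G. N \<le> lev G v \<and> (\<forall>v'\<in>V - G. key G v' = key G v \<longrightarrow> agree N q v')"
proof -
  obtain n where n: "\<forall>v\<in>X. agree n q v \<longrightarrow> v \<in> V"
    using V G(2) unfolding openin_cyl_topology by blast
  obtain v where v: "v \<in> X" "v \<notin> G" "agree (max n N) q v" using nd by blast
  have a: "agree n q v" "agree N q v"
    by (rule agree_mono[OF v(3)], simp)+
  have "G \<noteq> {}" using G(2) by blast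
  from lev_upper[OF G(1) this v(1,2) G(2) agree_sym[OF a(2)]] have N: "N \<le> lev G v" .
  have "agree N q v'" if "key G v' = key G v" for v'
  proof -
    have "agree (lev G v) v v'" using key_eq_agree that by metis
    then show ?thesis using a(2) N agree_mono agree_trans by blast
  qed
  then show ?thesis using v a n N by blast
qed

lemma injective_choice:
  assumes "countable K" "\<And>s. s \<in> K \<Longrightarrow> infinite (J s)"
  shows "\<exists>f. inj_on f K \<and> (\<forall>s\<in>K. f s \<in> J s)"
proof (cases "K = {}")
  case False
  have "\<exists>g. \<forall>n. g n \<in> J (from_nat_into K n) - g ` {..<n}"
  proof (rule dependent_wf_choice[of less_than])
    show "(r \<in> J (from_nat_into K x) - f ` {..<x}) = (r \<in> J (from_nat_into K x) - g ` {..<x})"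
      if "\<And>z. (z, x) \<in> less_than \<Longrightarrow> f z = g z" for f g x r
    proof -
      have "f ` {..<x} = g ` {..<x}" using that by (intro image_cong) auto
      then show ?thesis by simp
    qed
    show "\<exists>r. r \<in> J (from_nat_into K x) - f ` {..<x}" for x f
    proof -
      have "infinite (J (from_nat_into K x) - f ` {..<x})"
        using assms(2)[OF from_nat_into[OF False]] by (simp add: Diff_infinite_finite)
      then show ?thesis using infinite_imp_nonempty by blast
    qed
  qed simp
  then obtain g where g: "\<And>n. g n \<in> J (from_nat_into K n) - g ` {..<n}" by blast
  have "g m \<noteq> g n" if "m < n" for m n
    using g[of n] that by (metis DiffE imageI lessThan_iff)
  then have gne: "g m \<noteq> g n" if "m \<noteq> n" for m n
    using that by (metis nat_neq_iff)
  have "inj_on (g \<circ> to_nat_on K) K"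
    using gne assms(1) by (intro inj_onI) (metis comp_apply inj_on_contraD inj_on_to_nat_on)
  moreover have "\<forall>s\<in>K. (g \<circ> to_nat_on K) s \<in> J s"
  proof
    fix s assume "s \<in> K"
    then show "(g \<circ> to_nat_on K) s \<in> J s"
      using g[of "to_nat_on K s"] assms(1) by simp
  qed
  ultimately show ?thesis by blast
qed auto

text \<open>The complements of \<open>F\<close> and \<open>G\<close> are related piecewise through \<open>\<alpha> \<union> \<beta>\<close>. In a pair from \<open>\<alpha>\<close> the piece
on the side of \<open>G\<close> was chosen close to the \<open>\<Phi>\<close>-image of the representative of the other piece, and in a pair
from \<open>\<beta>\<close> it is the other way round; the precision is the index of the given piece in an enumeration. Near
\<open>x\<close> only pieces of high level occur, which excludes any finite set of pieces. So the precision
becomes arbitrarily good, and the continuity of \<open>\<Phi>\<close> carries over to the glued relation.\<close>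

lemma usc_glue:
  fixes X :: "(nat \<Rightarrow> 'b) set" and idx :: "'b list \<Rightarrow> nat"
  assumes F: "closedin (cyl_topology X) F" and G: "closedin (cyl_topology X) G"
    and U: "U \<subseteq> X" and V: "V \<subseteq> X"
    and \<Phi>: "Domain \<Phi> = F" "Range \<Phi> = G" "(x, y) \<in> \<Phi>" "settled \<Phi> x y"
    and idx: "inj_on idx (key F ` (U - F))" "inj_on idx' (key G ` (V - G))"
    and \<alpha>: "\<And>s v q. (s, key G v) \<in> \<alpha> \<Longrightarrow> v \<in> V - G \<Longrightarrow> (rep F s, q) \<in> \<Phi> \<Longrightarrow> agree (idx s) q v"
    and \<beta>: "\<And>t u p. (key F u, t) \<in> \<beta> \<Longrightarrow> u \<in> U - F \<Longrightarrow> (p, rep G t) \<in> \<Phi> \<Longrightarrow> agree (idx' t) p u"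
    and \<beta>_fun: "single_valued (\<beta>\<inverse>)"
  shows "usc (\<Phi> \<union> {(u, v). u \<in> U - F \<and> v \<in> V - G \<and> (key F u, key G v) \<in> \<alpha> \<union> \<beta>}) x y"
  unfolding usc_def
proof
  fix m
  have ne: "F \<noteq> {}" "G \<noteq> {}" using \<Phi> by auto
  have xF: "x \<in> F" and yG: "y \<in> G" using \<Phi> by auto
  have "usc \<Phi> x y" using \<Phi>(4) unfolding settled_def by simp
  then obtain k where k: "\<forall>u v. (u, v) \<in> \<Phi> \<longrightarrow> agree k x u \<longrightarrow> agree m y v"
    unfolding usc_def by meson
  \<comment> \<open>The finitely many pieces for which the precision is not yet good enough. The segments of \<open>y\<close> itself
are excluded as well: their pieces may have a representative near \<open>y\<close> without being near \<open>y\<close>.\<close>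
  define A where "A = {s \<in> key F ` (U - F). idx s < m}"
  define T where "T = {t \<in> key G ` (V - G). idx' t < k} \<union> (\<lambda>j. map y [0..<j]) ` {..<m}"
  define B where "B = {s. \<exists>t\<in>T. (s, t) \<in> \<beta>}"
  have "A = idx -` {..<m} \<inter> key F ` (U - F)" by (auto simp: A_def)
  then have finA: "finite A" using finite_vimage_IntI[OF _ idx(1)] by simp
  have "{t \<in> key G ` (V - G). idx' t < k} = idx' -` {..<k} \<inter> key G ` (V - G)" by auto
  then have "finite {t \<in> key G ` (V - G). idx' t < k}" using finite_vimage_IntI[OF _ idx(2)] by simp
  then have finT: "finite T" by (simp add: T_def)
  have "B \<subseteq> (\<lambda>t. THE s. (s, t) \<in> \<beta>) ` T"
  proof
    fix s assume "s \<in> B"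
    then obtain t where t: "t \<in> T" "(s, t) \<in> \<beta>" by (auto simp: B_def)
    then have the: "(THE s. (s, t) \<in> \<beta>) = s"
      using \<beta>_fun by (intro the_equality) (auto simp: single_valued_def)
    show "s \<in> (\<lambda>t. THE s. (s, t) \<in> \<beta>) ` T"
      using imageI[OF t(1), of "\<lambda>t. THE s. (s, t) \<in> \<beta>"] unfolding the .
  qed
  then have "finite B" using finT finite_subset by blast
  then have "finite (length ` (A \<union> B))" using finA by simp
  then obtain L where L: "\<And>s. s \<in> A \<union> B \<Longrightarrow> length s < L"
    by (metis finite_nat_set_iff_bounded imageI)
  have "agree m y v" if uv: "(u, v) \<in> \<Phi> \<union> {(u, v). u \<in> U - F \<and> v \<in> V - G \<and> (key F u, key G v) \<in> \<alpha> \<union> \<beta>}"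
    and xu: "agree (max k L) x u" for u v
  proof -
    have xu1: "agree k x u" by (rule agree_mono[OF xu]) simp
    from uv consider "(u, v) \<in> \<Phi>"
      | "u \<in> U - F" "v \<in> V - G" "(key F u, key G v) \<in> \<alpha>"
      | "u \<in> U - F" "v \<in> V - G" "(key F u, key G v) \<in> \<beta>" by auto
    then show ?thesis
    proof cases
      case 1
      then show ?thesis using k xu1 by blast
    next
      case 2
      then have u: "u \<in> X" "u \<notin> F" using U by auto
      have lv: "max k L \<le> lev F u"
        by (rule lev_upper[OF F ne(1) u xF agree_sym[OF xu]])
      have "key F u \<notin> A" using L[of "key F u"] lv by auto
      then have m: "m \<le> idx (key F u)" using 2(1) by (auto simp: A_def not_less)
      have "rep F (key F u) \<in> F" by (rule rep_key_in[OF F ne(1) u])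
      then obtain q where q: "(rep F (key F u), q) \<in> \<Phi>" using \<Phi> by auto
      have "agree k u (rep F (key F u))"
        by (rule agree_mono[OF rep_key_agree[OF F ne(1) u]]) (use lv in simp)
      then have "agree m y q" using k q xu1 agree_trans by blast
      moreover have "agree m q v" using \<alpha>[OF 2(3,2) q] m agree_mono by blast
      ultimately show ?thesis by (rule agree_trans)
    next
      case 3
      then have u: "u \<in> X" "u \<notin> F" and v: "v \<in> X" "v \<notin> G" using U V by auto
      have lv: "max k L \<le> lev F u"
        by (rule lev_upper[OF F ne(1) u xF agree_sym[OF xu]])
      have "key F u \<notin> B" using L[of "key F u"] lv by auto
      then have nT: "key G v \<notin> T" using 3(3) by (auto simp: B_def)
      have k': "k \<le> idx' (key G v)" using nT 3(2) by (auto simp: T_def not_less)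
      have "rep G (key G v) \<in> G" by (rule rep_key_in[OF G ne(2) v])
      then obtain p where p: "(p, rep G (key G v)) \<in> \<Phi>" using \<Phi> by auto
      have "agree k p u" using \<beta>[OF 3(3,1) p] k' agree_mono by blast
      then have "agree k x p" using xu1 agree_sym agree_trans by blast
      then have yq: "agree m y (rep G (key G v))" using k p by blast
      have vq: "agree (lev G v) v (rep G (key G v))" by (rule rep_key_agree[OF G ne(2) v])
      have "m \<le> lev G v"
      proof (rule ccontr)
        assume "\<not> m \<le> lev G v"
        then have less: "lev G v < m" by simp
        then have "agree (lev G v) v y"
          using yq vq agree_mono agree_sym agree_trans by (meson less_imp_le)
        then have "key G v = map y [0..<lev G v]" by (simp add: key_def agree_iff_map)
        then have "key G v \<in> T" using less by (auto simp: T_def)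
        then show False using nT by blast
      qed
      then show ?thesis using yq vq agree_mono agree_sym agree_trans by blast
    qed
  qed
  then show "\<exists>k. \<forall>u v. (u, v) \<in> \<Phi> \<union> {(u, v). u \<in> U - F \<and> v \<in> V - G \<and> (key F u, key G v) \<in> \<alpha> \<union> \<beta>} \<longrightarrow>
      agree k x u \<longrightarrow> agree m y v" by blast
qed


text \<open>First every piece on the left is assigned a piece on the right close to the image of its
representative, injectively; this is possible since infinitely many pieces accumulate there. Then
every remaining piece on the right is assigned a piece on the left in the same manner. Several pieces on
the right may thereby share a partner on the left; they are united to one side of a box,
which remains open.\<close>

theorem knaster_reichbach:
  fixes X :: "(nat \<Rightarrow> 'b) set"
  assumes C: "countable C" "\<And>x i. x \<in> X \<Longrightarrow> x i \<in> C"
    and U: "openin (cyl_topology X) U" and V: "openin (cyl_topology X) V"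
    and \<Phi>: "\<Phi> \<subseteq> U \<times> V" "\<Phi> \<noteq> {}" "\<And>x y. (x, y) \<in> \<Phi> \<Longrightarrow> settled \<Phi> x y"
    and cl: "closedin (cyl_topology X) (Domain \<Phi>)" "closedin (cyl_topology X) (Range \<Phi>)"
    and nd: "\<And>x n. x \<in> Domain \<Phi> \<Longrightarrow> \<exists>u\<in>X - Domain \<Phi>. agree n x u"
      "\<And>y n. y \<in> Range \<Phi> \<Longrightarrow> \<exists>v\<in>X - Range \<Phi>. agree n y v"
  shows "\<exists>S. \<Phi> \<subseteq> S \<and> S \<subseteq> U \<times> V \<and> Domain S = U \<and> Range S = V \<and>
    (\<forall>(x, y)\<in>\<Phi>. settled S x y) \<and> (\<forall>(x, y)\<in>S - \<Phi>. boxed X S x y)"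
proof -
  define F where "F = Domain \<Phi>"
  define G where "G = Range \<Phi>"
  define K where "K = key F ` (U - F)"
  define L where "L = key G ` (V - G)"
  note cl' = cl[folded F_def G_def] and nd' = nd[folded F_def G_def]
  have FU: "F \<subseteq> U" and GV: "G \<subseteq> V" and ne: "F \<noteq> {}" "G \<noteq> {}"
    using \<Phi>(1,2) by (auto simp: F_def G_def)
  have UX: "U \<subseteq> X" and VX: "V \<subseteq> X" using U V by (auto simp: openin_cyl_topology)
  have uniq: "y = y'" if "(x, y) \<in> \<Phi>" "(x, y') \<in> \<Phi>" for x y y'
    using settled_unique[OF \<Phi>(3)[OF that(2)] that(1)] .
  have uniq': "x = x'" if "(x, y) \<in> \<Phi>" "(x', y) \<in> \<Phi>" for x x' y
  proof -
    have "settled (\<Phi>\<inverse>) y x'" using \<Phi>(3)[OF that(2)] by (simp add: settled_converse)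
    then show ?thesis by (rule settled_unique) (use that(1) in simp)
  qed
  have "K \<subseteq> {map x [0..<n] | x n. x \<in> X}" "L \<subseteq> {map x [0..<n] | x n. x \<in> X}"
    using UX VX unfolding K_def L_def key_def by blast+
  then have cK: "countable K" and cL: "countable L"
    using countable_subset countable_prefixes[of C X] C by blast+
  define idx where "idx = to_nat_on K"
  define idx' where "idx' = to_nat_on L"
  have inj: "inj_on idx (key F ` (U - F))" "inj_on idx' (key G ` (V - G))"
    unfolding idx_def idx'_def using inj_on_to_nat_on[OF cK] inj_on_to_nat_on[OF cL]
    by (simp_all add: K_def L_def)

  have repF: "rep F s \<in> F" if "s \<in> K" for s
    using that rep_key_in[OF cl'(1) ne(1)] UX unfolding K_def by blast
  have repG: "rep G t \<in> G" if "t \<in> L" for t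
    using that rep_key_in[OF cl'(2) ne(2)] VX unfolding L_def by blast
  define J where "J s = {t \<in> L. \<forall>v\<in>V - G. key G v = t \<longrightarrow>
      (\<forall>q. (rep F s, q) \<in> \<Phi> \<longrightarrow> agree (idx s) q v)}" for s
  have infJ: "infinite (J s)" if sK: "s \<in> K" for s
  proof
    assume "finite (J s)"
    then have "finite (length ` J s)" by simp
    then obtain N where N: "\<And>t. t \<in> J s \<Longrightarrow> length t < N"
      by (metis finite_nat_set_iff_bounded imageI)
    obtain q where q: "(rep F s, q) \<in> \<Phi>" using repF[OF sK] by (auto simp: F_def)
    then have "q \<in> G" by (auto simp: G_def)
    obtain v where v: "v \<in> V - G" "max N (idx s) \<le> lev G v"
      "\<forall>v'\<in>V - G. key G v' = key G v \<longrightarrow> agree (max N (idx s)) q v'"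
      using keys_near[OF cl'(2) \<open>q \<in> G\<close> V GV, of "max N (idx s)"] nd'(2)[OF \<open>q \<in> G\<close>] by blast
    have "agree (idx s) q' v'" if "v' \<in> V - G" "key G v' = key G v" "(rep F s, q') \<in> \<Phi>" for v' q'
    proof -
      have "agree (max N (idx s)) q v'" using v(3) that by blast
      then have "agree (idx s) q v'" by (rule agree_mono) simp
      then show ?thesis using uniq[OF q that(3)] by simp
    qed
    then have "key G v \<in> J s" using v(1) by (auto simp: J_def L_def)
    then show False using N[of "key G v"] v(2) by auto
  qed
  obtain \<iota> where \<iota>: "inj_on \<iota> K" "\<And>s. s \<in> K \<Longrightarrow> \<iota> s \<in> J s"
    using injective_choice[of K J] cK infJ by blast
  have \<iota>L: "\<iota> s \<in> L" if "s \<in> K" for s using \<iota>(2)[OF that] by (auto simp: J_def)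
  have "\<exists>s\<in>K. \<forall>u\<in>U - F. key F u = s \<longrightarrow> (\<forall>p. (p, rep G t) \<in> \<Phi> \<longrightarrow> agree (idx' t) p u)"
    if t: "t \<in> L" for t
  proof -
    obtain p where p: "(p, rep G t) \<in> \<Phi>" using repG[OF t] by (auto simp: G_def)
    then have "p \<in> F" by (auto simp: F_def)
    obtain u where u: "u \<in> U - F" "\<forall>u'\<in>U - F. key F u' = key F u \<longrightarrow> agree (idx' t) p u'"
      using keys_near[OF cl'(1) \<open>p \<in> F\<close> U FU, of "idx' t"] nd'(1)[OF \<open>p \<in> F\<close>] by blast
    have "agree (idx' t) p' u'" if "u' \<in> U - F" "key F u' = key F u" "(p', rep G t) \<in> \<Phi>" for u' p'
      using u(2) that uniq'[OF p that(3)] by blast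
    then show ?thesis using u(1) unfolding K_def by blast
  qed
  then obtain \<rho> where \<rho>: "\<And>t. t \<in> L \<Longrightarrow> \<rho> t \<in> K"
    "\<And>t u p. t \<in> L \<Longrightarrow> u \<in> U - F \<Longrightarrow> key F u = \<rho> t \<Longrightarrow> (p, rep G t) \<in> \<Phi> \<Longrightarrow> agree (idx' t) p u"
    by metis

  define \<alpha> where "\<alpha> = {(s, t). s \<in> K \<and> t = \<iota> s}"
  define \<beta> where "\<beta> = {(s, t). t \<in> L - \<iota> ` K \<and> s = \<rho> t}"
  define S where "S = \<Phi> \<union> {(u, v). u \<in> U - F \<and> v \<in> V - G \<and> (key F u, key G v) \<in> \<alpha> \<union> \<beta>}"
  have functional: "s = s'" if "(s, t) \<in> \<alpha> \<union> \<beta>" "(s', t) \<in> \<alpha> \<union> \<beta>" for s s' t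
    using that \<iota>(1) by (auto simp: \<alpha>_def \<beta>_def inj_on_def)
  have \<alpha>_near: "agree (idx s) q v" if "(s, key G v) \<in> \<alpha>" "v \<in> V - G" "(rep F s, q) \<in> \<Phi>" for s v q
    using that \<iota>(2)[of s] unfolding \<alpha>_def J_def by auto
  have \<beta>_near: "agree (idx' t) p u" if "(key F u, t) \<in> \<beta>" "u \<in> U - F" "(p, rep G t) \<in> \<Phi>" for t u p
    using that \<rho>(2)[of t u p] unfolding \<beta>_def by auto
  have "usc S x y" if "(x, y) \<in> \<Phi>" for x y
    unfolding S_def
    by (rule usc_glue[OF cl' UX VX F_def[symmetric] G_def[symmetric] that \<Phi>(3)[OF that] inj \<alpha>_near \<beta>_near])
      (auto simp: \<beta>_def single_valued_def)
  moreover have "usc (S\<inverse>) y x" if "(x, y) \<in> \<Phi>" for x y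
  proof -
    have eq: "S\<inverse> = \<Phi>\<inverse> \<union> {(v, u). v \<in> V - G \<and> u \<in> U - F \<and> (key G v, key F u) \<in> \<beta>\<inverse> \<union> \<alpha>\<inverse>}"
      by (auto simp: S_def)
    have st: "settled (\<Phi>\<inverse>) y x" using \<Phi>(3)[OF that] by (simp add: settled_converse)
    have dr: "Domain (\<Phi>\<inverse>) = G" "Range (\<Phi>\<inverse>) = F" "(y, x) \<in> \<Phi>\<inverse>"
      using that by (auto simp: F_def G_def)
    show ?thesis
      unfolding eq
      by (rule usc_glue[OF cl'(2,1) VX UX dr st inj(2,1)])
        (use \<alpha>_near \<beta>_near in \<open>auto simp: \<alpha>_def single_valued_def\<close>)
  qed
  ultimately have "settled S x y" if "(x, y) \<in> \<Phi>" for x y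
    using that by (simp add: settled_def)
  moreover have "boxed X S u v" if uv: "(u, v) \<in> S - \<Phi>" for u v
  proof -
    have u: "u \<in> U - F" and v: "v \<in> V - G" and k: "(key F u, key G v) \<in> \<alpha> \<union> \<beta>"
      using uv by (auto simp: S_def)
    define U' where "U' = {u' \<in> U - F. key F u' = key F u}"
    define V' where "V' = {v' \<in> V - G. (key F u, key G v') \<in> \<alpha> \<union> \<beta>}"
    have "openin (cyl_topology X) U'" "openin (cyl_topology X) V'"
      unfolding U'_def V'_def
      using openin_keys[OF cl'(1) ne(1) U, of "\<lambda>s. s = key F u"]
        openin_keys[OF cl'(2) ne(2) V, of "\<lambda>t. (key F u, t) \<in> \<alpha> \<union> \<beta>"] by simp_all
    moreover have "U' \<times> V' \<subseteq> S" unfolding U'_def V'_def S_def by auto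
    moreover have "a \<in> U' \<longleftrightarrow> b \<in> V'" if "(a, b) \<in> S" for a b
    proof (cases "(a, b) \<in> \<Phi>")
      case True
      then show ?thesis by (auto simp: U'_def V'_def F_def G_def)
    next
      case False
      then have ab: "a \<in> U - F" "b \<in> V - G" "(key F a, key G b) \<in> \<alpha> \<union> \<beta>"
        using that by (auto simp: S_def)
      then show ?thesis
        using functional[OF ab(3), of "key F u"] by (auto simp: U'_def V'_def)
    qed
    ultimately show ?thesis
      unfolding boxed_def using u v k
      by (intro exI[of _ U'] exI[of _ V']) (auto simp: U'_def V'_def)
  qed
  moreover have "\<Phi> \<subseteq> S" "S \<subseteq> U \<times> V" using \<Phi>(1) by (auto simp: S_def)
  moreover have "U \<subseteq> Domain S"
  proof
    fix u assume u: "u \<in> U"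
    show "u \<in> Domain S"
    proof (cases "u \<in> F")
      case True
      then show ?thesis by (auto simp: S_def F_def)
    next
      case False
      then have K: "key F u \<in> K" using u by (auto simp: K_def)
      then obtain v where "v \<in> V - G" "key G v = \<iota> (key F u)" using \<iota>L unfolding L_def by fastforce
      then have "(u, v) \<in> S" using u False K by (auto simp: S_def \<alpha>_def)
      then show ?thesis by blast
    qed
  qed
  moreover have "V \<subseteq> Range S"
  proof
    fix v assume v: "v \<in> V"
    show "v \<in> Range S"
    proof (cases "v \<in> G")
      case True
      then show ?thesis by (auto simp: S_def G_def)
    next
      case False
      then have L: "key G v \<in> L" using v by (auto simp: L_def)
      obtain s where s: "s \<in> K" "(s, key G v) \<in> \<alpha> \<union> \<beta>"
      proof (cases "key G v \<in> \<iota> ` K")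
        case True
        then show ?thesis using that by (auto simp: \<alpha>_def)
      next
        case False
        then show ?thesis using that[of "\<rho> (key G v)"] L \<rho>(1) by (auto simp: \<beta>_def)
      qed
      then obtain u where "u \<in> U - F" "key F u = s" by (auto simp: K_def)
      then have "(u, v) \<in> S" using v False s by (auto simp: S_def)
      then show ?thesis by blast
    qed
  qed
  ultimately show ?thesis by (intro exI[of _ S]) blast
qed

section \<open>The back-and-forth argument\<close>

text \<open>The last two assumptions are what makes the back-and-forth argument work. The graph of \<open>e\<close> being
settled at each of its points says that \<open>e\<close> is a homeomorphism onto its image.\<close>

locale self_absorbing =
  fixes X :: "(nat \<Rightarrow> 'b) set" and C :: "'b set"
  assumes nonempty: "X \<noteq> {}"
    and countable_values: "countable C" "\<And>x i. x \<in> X \<Longrightarrow> x i \<in> C"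
    and co_F_sigma: "\<And>D. countable D \<Longrightarrow> D \<subseteq> X \<Longrightarrow>
      \<exists>\<A>. countable \<A> \<and> (\<forall>A\<in>\<A>. closedin (cyl_topology X) A) \<and> \<Union>\<A> = X - D"
    and absorb: "\<And>V E. openin (cyl_topology X) V \<Longrightarrow> V \<noteq> {} \<Longrightarrow> countable E \<Longrightarrow>
      \<exists>e. e ` X \<subseteq> V - E \<and> (\<forall>A. closedin (cyl_topology X) A \<longrightarrow> closedin (cyl_topology X) (e ` A)) \<and>
        (\<forall>x\<in>X. settled {(x, e x) | x. x \<in> X} x (e x))"
begin

lemma crowded: "x \<in> X \<Longrightarrow> \<exists>u\<in>X. u \<noteq> x \<and> agree n x u"
proof -
  assume x: "x \<in> X"
  have "openin (cyl_topology X) {y\<in>X. agree n x y}" by (rule openin_cylinder)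
  moreover have "{y\<in>X. agree n x y} \<noteq> {}" using x agree_refl by blast
  ultimately obtain e where "e ` X \<subseteq> {y\<in>X. agree n x y} - {x}"
    using absorb[of "{y\<in>X. agree n x y}" "{x}"] by auto
  then have "e x \<in> {y\<in>X. agree n x y} - {x}" using x by blast
  then show ?thesis by blast
qed

lemma partial_match_full:
  assumes "openin (cyl_topology X) U" "openin (cyl_topology X) V" "U \<noteq> {}" "V \<noteq> {}"
  shows "partial_match X D E U V (U \<times> V)"
proof -
  have "boxed X (U \<times> V) x y" if "x \<in> U" "y \<in> V" for x y
    unfolding boxed_def by (intro exI[of _ U] exI[of _ V]) (use that assms in auto)
  then show ?thesis using assms(3,4) unfolding partial_match_def by auto
qed

lemma partial_match_extending:
  assumes "openin (cyl_topology X) U" "openin (cyl_topology X) V"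
    and "\<Phi> \<subseteq> U \<times> V" "\<Phi> \<noteq> {}" "\<And>x y. (x, y) \<in> \<Phi> \<Longrightarrow> settled \<Phi> x y"
    and "closedin (cyl_topology X) (Domain \<Phi>)" "closedin (cyl_topology X) (Range \<Phi>)"
    and "\<And>x n. x \<in> Domain \<Phi> \<Longrightarrow> \<exists>u\<in>X - Domain \<Phi>. agree n x u"
      "\<And>y n. y \<in> Range \<Phi> \<Longrightarrow> \<exists>v\<in>X - Range \<Phi>. agree n y v"
    and DE: "\<And>x y. (x, y) \<in> \<Phi> \<Longrightarrow> x \<in> D \<longleftrightarrow> y \<in> E"
  shows "\<exists>S. partial_match X D E U V S \<and> (\<forall>x\<in>Domain \<Phi>. \<exists>y. (x, y) \<in> S \<and> settled S x y)"
proof -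
  have "\<exists>S. \<Phi> \<subseteq> S \<and> S \<subseteq> U \<times> V \<and> Domain S = U \<and> Range S = V \<and>
      (\<forall>(x, y)\<in>\<Phi>. settled S x y) \<and> (\<forall>(x, y)\<in>S - \<Phi>. boxed X S x y)"
    by (rule knaster_reichbach[of C X]) (fact countable_values assms)+
  then obtain S where S: "\<Phi> \<subseteq> S" "S \<subseteq> U \<times> V" "Domain S = U" "Range S = V"
    "\<forall>(x, y)\<in>\<Phi>. settled S x y" "\<forall>(x, y)\<in>S - \<Phi>. boxed X S x y"
    by blast
  have "partial_match X D E U V S"
    unfolding partial_match_def using S DE by blast
  moreover have "\<exists>y. (x, y) \<in> S \<and> settled S x y" if "x \<in> Domain \<Phi>" for x
    using that S(1,5) by blast
  ultimately show ?thesis by blast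
qed

text \<open>The closed sets that can be settled in one step: either \<open>A\<close> is embedded into the complement of \<open>E\<close>, or the
single point of \<open>A\<close> is sent to a point of \<open>E\<close>. Both kinds are nowhere dense.\<close>

definition task :: "(nat \<Rightarrow> 'b) set \<Rightarrow> (nat \<Rightarrow> 'b) set \<Rightarrow> bool"
  where "task D A \<longleftrightarrow> closedin (cyl_topology X) A \<and> (A \<inter> D = {} \<or> (\<exists>d\<in>D. A = {d}))"

text \<open>Settling \<open>A\<close> inside one box. Density of \<open>D\<close> and \<open>E\<close> makes \<open>A \<inter> U\<close> and its image nowhere
dense, since these sets avoid \<open>D\<close> and \<open>E\<close> respectively; a singleton is nowhere dense by \<open>crowded\<close>.\<close>

lemma local_step:
  assumes D: "dense_subset (cyl_topology X) D" and E: "countable E" "dense_subset (cyl_topology X) E"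
    and U: "openin (cyl_topology X) U" "closedin (cyl_topology X) U" "U \<noteq> {}"
    and V: "openin (cyl_topology X) V" "V \<noteq> {}"
    and A: "task D A"
  shows "\<exists>S. partial_match X D E U V S \<and> (\<forall>x\<in>A \<inter> U. \<exists>y. (x, y) \<in> S \<and> settled S x y)"
proof (cases "A \<inter> U = {}")
  case True
  then show ?thesis using partial_match_full[OF U(1) V(1) U(3) V(2)] by blast
next
  case False
  have UX: "U \<subseteq> X" and VX: "V \<subseteq> X" using U V by (auto simp: openin_cyl_topology)
  have dense: "D \<subseteq> X" "E \<subseteq> X" "\<And>x n. x \<in> X \<Longrightarrow> \<exists>d\<in>D. agree n x d" "\<And>x n. x \<in> X \<Longrightarrow> \<exists>d\<in>E. agree n x d"
    using D E(2) unfolding dense_subset_cyl_topology by blast+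
  have cl: "closedin (cyl_topology X) A" using A by (simp add: task_def)
  have "A \<inter> D = {} \<or> (\<exists>d\<in>D. A = {d})" using A by (simp add: task_def)
  then show ?thesis
  proof
    assume AD: "A \<inter> D = {}"
    obtain e where e: "e ` X \<subseteq> V - E"
      "\<And>B. closedin (cyl_topology X) B \<Longrightarrow> closedin (cyl_topology X) (e ` B)"
      "\<And>x. x \<in> X \<Longrightarrow> settled {(x, e x) | x. x \<in> X} x (e x)"
      using absorb[OF V E(1)] by blast
    define \<Phi> where "\<Phi> = {(x, e x) | x. x \<in> A \<inter> U}"
    have dom: "Domain \<Phi> = A \<inter> U" and ran: "Range \<Phi> = e ` (A \<inter> U)" by (auto simp: \<Phi>_def)
    have clAU: "closedin (cyl_topology X) (A \<inter> U)" by (rule closedin_Int[OF cl U(2)])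
    have "\<exists>S. partial_match X D E U V S \<and> (\<forall>x\<in>Domain \<Phi>. \<exists>y. (x, y) \<in> S \<and> settled S x y)"
    proof (rule partial_match_extending[OF U(1) V(1)])
      show "\<Phi> \<subseteq> U \<times> V" using e(1) UX by (auto simp: \<Phi>_def)
      show "\<Phi> \<noteq> {}" using False by (auto simp: \<Phi>_def)
      show "settled \<Phi> x y" if "(x, y) \<in> \<Phi>" for x y
      proof -
        have "x \<in> X" "y = e x" using that UX by (auto simp: \<Phi>_def)
        moreover have "\<Phi> \<subseteq> {(x, e x) | x. x \<in> X}" using UX by (auto simp: \<Phi>_def)
        ultimately show ?thesis using settled_mono e(3) by blast
      qed
      show "closedin (cyl_topology X) (Domain \<Phi>)" "closedin (cyl_topology X) (Range \<Phi>)"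
        unfolding dom ran using clAU e(2) by simp_all
      show "\<exists>u\<in>X - Domain \<Phi>. agree n x u" if "x \<in> Domain \<Phi>" for x n
      proof -
        have "x \<in> X" using that UX dom by blast
        from dense(3)[OF this] obtain d where "d \<in> D" "agree n x d" by blast
        then show ?thesis using dense(1) AD dom by blast
      qed
      show "\<exists>v\<in>X - Range \<Phi>. agree n y v" if "y \<in> Range \<Phi>" for y n
      proof -
        have sub: "Range \<Phi> \<subseteq> V - E" using ran e(1) UX by auto
        then have "y \<in> X" using that VX by blast
        from dense(4)[OF this] obtain d where "d \<in> E" "agree n y d" by blast
        then show ?thesis using dense(2) sub by blast
      qed
      show "x \<in> D \<longleftrightarrow> y \<in> E" if "(x, y) \<in> \<Phi>" for x y
      proof -
        have "x \<in> A" "x \<in> X" "y = e x" using that UX by (auto simp: \<Phi>_def)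
        then have "x \<notin> D" "y \<notin> E" using AD e(1) by blast+
        then show ?thesis by simp
      qed
    qed
    then show ?thesis using dom by simp
  next
    assume "\<exists>d\<in>D. A = {d}"
    then obtain d where d: "d \<in> D" "A = {d}" by blast
    then have dU: "d \<in> U" using False by blast
    obtain v where "v \<in> V" using V(2) by blast
    then obtain n where "\<forall>y\<in>X. agree n v y \<longrightarrow> y \<in> V"
      using V(1) unfolding openin_cyl_topology by blast
    then obtain e where e: "e \<in> E" "e \<in> V" using dense(2) dense(4)[of v n] \<open>v \<in> V\<close> VX by blast
    define \<Phi> where "\<Phi> = {(d, e)}"
    have dX: "d \<in> X" and eX: "e \<in> X" using dense d e by blast+
    have "\<exists>S. partial_match X D E U V S \<and> (\<forall>x\<in>Domain \<Phi>. \<exists>y. (x, y) \<in> S \<and> settled S x y)"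
    proof (rule partial_match_extending[OF U(1) V(1)])
      show "settled \<Phi> x y" if "(x, y) \<in> \<Phi>" for x y
        using that by (auto simp: \<Phi>_def settled_def usc_def)
      show "closedin (cyl_topology X) (Domain \<Phi>)" "closedin (cyl_topology X) (Range \<Phi>)"
        using closedin_singleton[OF dX] closedin_singleton[OF eX] by (simp_all add: \<Phi>_def)
      show "\<exists>u\<in>X - Domain \<Phi>. agree n x u" if "x \<in> Domain \<Phi>" for x n
        using that crowded[OF dX, of n] by (auto simp: \<Phi>_def)
      show "\<exists>v\<in>X - Range \<Phi>. agree n y v" if "y \<in> Range \<Phi>" for y n
        using that crowded[OF eX, of n] by (auto simp: \<Phi>_def)
    qed (use dU d e in \<open>auto simp: \<Phi>_def\<close>)
    moreover have "Domain \<Phi> = A \<inter> U" using d(2) dU by (auto simp: \<Phi>_def)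
    ultimately show ?thesis by simp
  qed
qed

text \<open>The boxes of \<open>R\<close> are disjoint on both sides, so the local step can be performed in all of them at
once.\<close>

lemma global_step:
  assumes D: "dense_subset (cyl_topology X) D" and E: "countable E" "dense_subset (cyl_topology X) E"
    and R: "partial_match X D E X X R" and A: "task D A"
  shows "\<exists>R'\<subseteq>R. partial_match X D E X X R' \<and> (\<forall>x\<in>A. \<exists>y. (x, y) \<in> R' \<and> settled R' x y)"
proof -
  define good where "good U V S \<longleftrightarrow>
    partial_match X D E U V S \<and> (\<forall>x\<in>A \<inter> U. \<exists>y. (x, y) \<in> S \<and> settled S x y)" for U V S
  define sel where "sel U V = (SOME S. good U V S)" for U V
  \<comment> \<open>For a boxed pair, the two sides of its box are recovered from \<open>R\<close> as the image of \<open>x\<close> and the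
preimage of \<open>y\<close>, so that pairs in the same box select the same relation.\<close>
  define sec where "sec x y = sel (R\<inverse> `` {y}) (R `` {x})" for x y
  define R' where "R' = {(x, y) \<in> R. \<not> boxed X R x y \<or> (x, y) \<in> sec x y}"
  have RX: "R \<subseteq> X \<times> X" "Domain R = X" "Range R = X" using R by (auto simp: partial_match_def)
  define box where "box U V \<longleftrightarrow> openin (cyl_topology X) U \<and> openin (cyl_topology X) V \<and>
    U \<times> V \<subseteq> R \<and> (\<forall>(u, v)\<in>R. u \<in> U \<longleftrightarrow> v \<in> V)" for U V
  have box_of: "\<exists>U V. x \<in> U \<and> y \<in> V \<and> box U V" if "boxed X R x y" for x y
    using that unfolding boxed_def box_def by (elim exE conjE) (intro exI conjI)
  have boxed_of: "boxed X R u v" if "box U V" "u \<in> U" "v \<in> V" for U V u v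
    unfolding boxed_def using that unfolding box_def by (intro exI[of _ U] exI[of _ V]) simp
  have box_R: "(u, v) \<in> R \<and> u \<in> U \<and> v \<in> V \<longleftrightarrow> u \<in> U \<and> v \<in> V"
    "(u, v) \<in> R \<Longrightarrow> u \<in> U \<longleftrightarrow> v \<in> V" if "box U V" for U V u v
    using that unfolding box_def by blast+
  have sec_eq: "sec u v = sel U V" if B: "box U V" "u \<in> U" "v \<in> V" for U V u v
  proof -
    have "R\<inverse> `` {v} = U" "R `` {u} = V" using box_R[OF B(1)] B(2,3) by blast+
    then show ?thesis by (simp add: sec_def)
  qed
  have good_sel: "good U V (sel U V)" if B: "box U V" "u \<in> U" "v \<in> V" for U V u v
  proof -
    have op: "openin (cyl_topology X) U" "openin (cyl_topology X) V" "U \<times> V \<subseteq> R"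
      "\<forall>(u, v)\<in>R. u \<in> U \<longleftrightarrow> v \<in> V" using B(1) by (simp_all add: box_def)
    have "closedin (cyl_topology X) U" by (rule box_closed[OF R op(1) B(3) op(3,4)])
    moreover have "U \<noteq> {}" "V \<noteq> {}" using B by auto
    ultimately obtain S where "good U V S"
      unfolding good_def using local_step[OF D E op(1) _ _ op(2) _ A] by blast
    then show ?thesis unfolding sel_def by (rule someI)
  qed
  have match_sel: "partial_match X D E U V (sel U V)" if "box U V" "u \<in> U" "v \<in> V" for U V u v
    using good_sel[OF that] unfolding good_def by simp
  have sel_sub: "u' \<in> U \<and> v' \<in> V" if "box U V" "u \<in> U" "v \<in> V" "(u', v') \<in> sel U V" for U V u v u' v'
    using match_sel[OF that(1-3)] that(4) unfolding partial_match_def by blast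
  have R'R: "R' \<subseteq> R" by (auto simp: R'_def)
  have R'X: "R' \<subseteq> X \<times> X" using R'R RX by blast
  have inside: "(u', v') \<in> R' \<longleftrightarrow> (u', v') \<in> sel U V"
    if B: "box U V" "u \<in> U" "v \<in> V" and uv: "u' \<in> U \<or> v' \<in> V" for U V u v u' v'
  proof
    assume *: "(u', v') \<in> R'"
    then have "(u', v') \<in> R" using R'R by blast
    then have UV: "u' \<in> U" "v' \<in> V" using box_R(2)[OF B(1)] uv by blast+
    then show "(u', v') \<in> sel U V"
      using * boxed_of[OF B(1) UV] sec_eq[OF B(1) UV] by (simp add: R'_def)
  next
    assume *: "(u', v') \<in> sel U V"
    then have UV: "u' \<in> U" "v' \<in> V" using sel_sub[OF B] by blast+
    then have "(u', v') \<in> R" using box_R(1)[OF B(1)] by blast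
    then show "(u', v') \<in> R'"
      using * sec_eq[OF B(1) UV] by (simp add: R'_def)
  qed
  have settled_in: "settled R' x y" if B: "box U V" "x \<in> U" "y \<in> V" and "settled (sel U V) x y" for x y U V
  proof (rule settled_local[OF that(4) _ _ B(2,3) R'X])
    show "openin (cyl_topology X) U" "openin (cyl_topology X) V" using B(1) by (simp_all add: box_def)
    show "(u, v) \<in> sel U V" if "(u, v) \<in> R'" "u \<in> U \<or> v \<in> V" for u v
      using inside[OF B that(2)] that(1) by simp
  qed
  have total: "x \<in> Domain R' \<and> y \<in> Range R'" if xy: "(x, y) \<in> R" for x y
  proof (cases "boxed X R x y")
    case False
    then have "(x, y) \<in> R'" using xy by (simp add: R'_def)
    then show ?thesis by blast
  next
    case True
    from box_of[OF this] obtain U V where B: "box U V" "x \<in> U" "y \<in> V" by blast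
    then obtain x' y' where "(x, y') \<in> sel U V" "(x', y) \<in> sel U V"
      using match_sel[OF B] unfolding partial_match_def by blast
    then have "(x, y') \<in> R'" "(x', y) \<in> R'" using inside[OF B] B by simp_all
    then show ?thesis by blast
  qed
  have "partial_match X D E X X R'"
    unfolding partial_match_def
  proof (intro conjI)
    show "R' \<subseteq> X \<times> X" by fact
    show "Domain R' = X" "Range R' = X" using total R'X RX by blast+
    show "\<forall>(x, y)\<in>R'. settled R' x y \<and> (x \<in> D \<longleftrightarrow> y \<in> E) \<or> boxed X R' x y"
    proof clarify
      fix x y assume xy: "(x, y) \<in> R'" and nb: "\<not> boxed X R' x y"
      have xyR: "(x, y) \<in> R" using xy R'R by blast
      show "settled R' x y \<and> (x \<in> D \<longleftrightarrow> y \<in> E)"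
      proof (cases "boxed X R x y")
        case False
        then have "settled R x y \<and> (x \<in> D \<longleftrightarrow> y \<in> E)"
          using R xyR unfolding partial_match_def by blast
        then show ?thesis using settled_mono[OF _ R'R] by blast
      next
        case True
        from box_of[OF this] obtain U V where B: "box U V" "x \<in> U" "y \<in> V" by blast
        have "(x, y) \<in> sel U V" using inside[OF B] B(2) xy by blast
        then have "settled (sel U V) x y \<and> (x \<in> D \<longleftrightarrow> y \<in> E) \<or> boxed X (sel U V) x y"
          using match_sel[OF B] unfolding partial_match_def by blast
        moreover have "\<not> boxed X (sel U V) x y"
        proof
          assume "boxed X (sel U V) x y"
          then obtain U' V' where B': "x \<in> U'" "y \<in> V'" "openin (cyl_topology X) U'"
            "openin (cyl_topology X) V'" "U' \<times> V' \<subseteq> sel U V" "\<forall>(u, v)\<in>sel U V. u \<in> U' \<longleftrightarrow> v \<in> V'"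
            unfolding boxed_def by (elim exE conjE) simp
          have sub: "U' \<subseteq> U" "V' \<subseteq> V" using sel_sub[OF B] B'(1,2,5) by blast+
          have "(u, v) \<in> R'" if "u \<in> U'" "v \<in> V'" for u v
            using inside[OF B, of u v] B'(5) sub that by blast
          then have 1: "U' \<times> V' \<subseteq> R'" by blast
          have "u \<in> U' \<longleftrightarrow> v \<in> V'" if "(u, v) \<in> R'" for u v
            using inside[OF B, of u v] B'(6) sub that by blast
          then have 2: "\<forall>(u, v)\<in>R'. u \<in> U' \<longleftrightarrow> v \<in> V'" by blast
          have "boxed X R' x y"
            unfolding boxed_def using B'(1-4) 1 2 by (intro exI[of _ U'] exI[of _ V']) simp
          then show False using nb by simp
        qed
        ultimately have "settled (sel U V) x y" "x \<in> D \<longleftrightarrow> y \<in> E" by blast+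
        then show ?thesis using settled_in[OF B] by blast
      qed
    qed
  qed
  moreover have "\<exists>y. (x, y) \<in> R' \<and> settled R' x y" if xA: "x \<in> A" for x
  proof -
    have "x \<in> X" using that A closedin_subset[of "cyl_topology X" A] by (auto simp: task_def)
    then obtain y where xy: "(x, y) \<in> R" using RX by blast
    show ?thesis
    proof (cases "boxed X R x y")
      case False
      then have "settled R x y" using R xy unfolding partial_match_def by blast
      then show ?thesis using False xy settled_mono[OF _ R'R] by (auto simp: R'_def)
    next
      case True
      from box_of[OF this] obtain U V where B: "box U V" "x \<in> U" "y \<in> V" by blast
      have "\<forall>x\<in>A \<inter> U. \<exists>y. (x, y) \<in> sel U V \<and> settled (sel U V) x y"
        using good_sel[OF B] by (simp add: good_def)
      then obtain y' where y': "(x, y') \<in> sel U V" "settled (sel U V) x y'"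
        using B(2) xA by blast
      have "y' \<in> V" using sel_sub[OF B y'(1)] by simp
      then have "settled R' x y'" using settled_in[OF B(1,2) _ y'(2)] by simp
      moreover have "(x, y') \<in> R'" using inside[OF B] B(2) y'(1) by simp
      ultimately show ?thesis by blast
    qed
  qed
  ultimately show ?thesis using R'R by (intro exI[of _ R']) blast
qed

lemma two_sided_step:
  assumes D: "countable D" "dense_subset (cyl_topology X) D"
    and E: "countable E" "dense_subset (cyl_topology X) E"
    and R: "partial_match X D E X X R" and A: "task D A" and B: "task E B"
  shows "\<exists>R'\<subseteq>R. partial_match X D E X X R' \<and> (\<forall>x\<in>A. \<exists>y. (x, y) \<in> R' \<and> settled R' x y) \<and>
    (\<forall>y\<in>B. \<exists>x. (x, y) \<in> R' \<and> settled R' x y)"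
proof -
  obtain R1 where R1: "R1 \<subseteq> R" "partial_match X D E X X R1"
    "\<forall>x\<in>A. \<exists>y. (x, y) \<in> R1 \<and> settled R1 x y"
    using global_step[OF D(2) E R A] by blast
  obtain R2 where R2: "R2 \<subseteq> R1\<inverse>" "partial_match X E D X X R2"
    "\<forall>y\<in>B. \<exists>x. (y, x) \<in> R2 \<and> settled R2 y x"
    using global_step[OF E(2) D partial_match_converse[OF R1(2)] B] by blast
  have sub: "R2\<inverse> \<subseteq> R1" using R2(1) by blast
  have m: "partial_match X D E X X (R2\<inverse>)" by (rule partial_match_converse[OF R2(2)])
  have "\<exists>y. (x, y) \<in> R2\<inverse> \<and> settled (R2\<inverse>) x y" if xA: "x \<in> A" for x
  proof -
    obtain y where y: "settled R1 x y" using R1(3) xA by blast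
    have "x \<in> X" using that A closedin_subset[of "cyl_topology X" A] by (auto simp: task_def)
    then obtain y' where "(x, y') \<in> R2\<inverse>" using m unfolding partial_match_def by blast
    moreover from this sub have "y' = y" using settled_unique[OF y] by blast
    ultimately show ?thesis using settled_mono[OF y sub] by blast
  qed
  moreover have "\<exists>x. (x, y) \<in> R2\<inverse> \<and> settled (R2\<inverse>) x y" if yB: "y \<in> B" for y
  proof -
    obtain x where "(y, x) \<in> R2" "settled R2 y x" using R2(3) yB by blast
    then show ?thesis by (intro exI[of _ x]) (simp add: settled_converse)
  qed
  ultimately show ?thesis using m sub R1(1) by (intro exI[of _ "R2\<inverse>"]) blast
qed

lemma task_cover:
  assumes "countable D" "dense_subset (cyl_topology X) D"
  shows "\<exists>A :: nat \<Rightarrow> (nat \<Rightarrow> 'b) set. (\<forall>n. task D (A n)) \<and> (\<Union>n. A n) = X"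
proof -
  have DX: "D \<subseteq> X" using assms(2) by (simp add: dense_subset_cyl_topology)
  obtain \<A> where \<A>: "countable \<A>" "\<forall>A\<in>\<A>. closedin (cyl_topology X) A" "\<Union>\<A> = X - D"
    using co_F_sigma[OF assms(1) DX] by meson
  define \<B> where "\<B> = \<A> \<union> (\<lambda>d. {d}) ` D"
  have "D \<noteq> {}" using assms(2) nonempty by (auto simp: dense_subset_cyl_topology)
  then have ne: "\<B> \<noteq> {}" by (auto simp: \<B>_def)
  have cB: "countable \<B>" using \<A>(1) assms(1) by (simp add: \<B>_def)
  have "task D B" if B: "B \<in> \<B>" for B
  proof (cases "B \<in> \<A>")
    case True
    then have "closedin (cyl_topology X) B" "B \<inter> D = {}" using \<A>(2,3) by auto
    then show ?thesis by (simp add: task_def)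
  next
    case False
    then obtain d where "d \<in> D" "B = {d}" using B by (auto simp: \<B>_def)
    then show ?thesis using closedin_singleton[of d] DX by (auto simp: task_def)
  qed
  then have "task D (from_nat_into \<B> n)" for n using from_nat_into[OF ne] by blast
  moreover have "(\<Union>n. from_nat_into \<B> n) = X"
  proof -
    have "(\<Union>n. from_nat_into \<B> n) = \<Union>\<B>" using range_from_nat_into[OF ne cB] by simp
    also have "\<dots> = X" using \<A>(3) DX by (auto simp: \<B>_def)
    finally show ?thesis .
  qed
  ultimately show ?thesis by blast
qed

text \<open>A point settled at stage \<open>N x\<close> keeps its value for ever: later relations are smaller but still total.
Continuity at \<open>x\<close> is read off from stage \<open>N x\<close> alone.\<close>

lemma homeomorphism_of_matches:
  assumes R: "\<And>n. partial_match X D E X X (R n)" "\<And>n. R (Suc n) \<subseteq> R n"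
    and left: "\<And>x. x \<in> X \<Longrightarrow> \<exists>n y. (x, y) \<in> R n \<and> settled (R n) x y \<and> (x \<in> D \<longleftrightarrow> y \<in> E)"
  shows "\<exists>h. continuous_map (cyl_topology X) (cyl_topology X) h \<and>
    (\<forall>x\<in>X. (x \<in> D \<longleftrightarrow> h x \<in> E) \<and> (\<forall>y. (\<forall>n. (x, y) \<in> R n) \<longleftrightarrow> y = h x))"
proof -
  have mono: "R n \<subseteq> R m" if "m \<le> n" for m n
    using that R(2) by (rule lift_Suc_antimono_le[of R, rotated])
  from left obtain N h where h: "\<And>x. x \<in> X \<Longrightarrow> (x, h x) \<in> R (N x)"
    "\<And>x. x \<in> X \<Longrightarrow> settled (R (N x)) x (h x)" "\<And>x. x \<in> X \<Longrightarrow> x \<in> D \<longleftrightarrow> h x \<in> E"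
    by metis
  have all: "(x, h x) \<in> R n" if x: "x \<in> X" for x n
  proof (cases "n \<le> N x")
    case True
    then show ?thesis using mono h(1)[OF x] by blast
  next
    case False
    obtain y where y: "(x, y) \<in> R n" using R(1)[of n] x unfolding partial_match_def by auto
    then have "(x, y) \<in> R (N x)" using mono[of "N x" n] False by auto
    then have "y = h x" using settled_unique h(2)[OF x] by blast
    then show ?thesis using y by simp
  qed
  have hX: "h x \<in> X" if "x \<in> X" for x
    using all[OF that, of 0] R(1)[of 0] unfolding partial_match_def by blast
  have "continuous_map (cyl_topology X) (cyl_topology X) h"
    unfolding continuous_map_def topspace_cyl_topology
  proof (intro conjI allI impI)
    show "h \<in> X \<rightarrow> X" using hX by blast
    fix W assume W: "openin (cyl_topology X) W"
    show "openin (cyl_topology X) {x \<in> X. h x \<in> W}"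
      unfolding openin_cyl_topology
    proof (intro conjI ballI)
      fix x assume x: "x \<in> {x \<in> X. h x \<in> W}"
      then obtain m where m: "\<forall>y\<in>X. agree m (h x) y \<longrightarrow> y \<in> W"
        using W unfolding openin_cyl_topology by blast
      have "usc (R (N x)) x (h x)" using h(2) x unfolding settled_def by simp
      then obtain k where k: "\<forall>u v. (u, v) \<in> R (N x) \<longrightarrow> agree k x u \<longrightarrow> agree m (h x) v"
        unfolding usc_def by meson
      have "\<forall>y\<in>X. agree k x y \<longrightarrow> y \<in> {x \<in> X. h x \<in> W}"
      proof (intro ballI impI)
        fix u assume u: "u \<in> X" "agree k x u"
        then have "agree m (h x) (h u)" using k all[OF u(1), of "N x"] by simp
        then show "u \<in> {x \<in> X. h x \<in> W}" using m hX u(1) by simp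
      qed
      then show "\<exists>n. \<forall>y\<in>X. agree n x y \<longrightarrow> y \<in> {x \<in> X. h x \<in> W}" by blast
    qed simp
  qed
  moreover have "(\<forall>n. (x, y) \<in> R n) \<longleftrightarrow> y = h x" if "x \<in> X" for x y
    using all[OF that] settled_unique[OF h(2)[OF that]] by blast
  ultimately show ?thesis using h(3) by blast
qed

text \<open>The relations settle the \<open>n\<close>-th set of either cover at step \<open>n\<close>. The intersection is a function in both
directions by \<open>homeomorphism_of_matches\<close>, applied also to the converse relations.\<close>

theorem countable_dense_homogeneous_cyl: "countable_dense_homogeneous (cyl_topology X)"
  unfolding countable_dense_homogeneous_def
proof (intro allI impI)
  fix D E
  assume "countable D \<and> dense_subset (cyl_topology X) D \<and> countable E \<and> dense_subset (cyl_topology X) E"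
  then have D: "countable D" "dense_subset (cyl_topology X) D"
    and E: "countable E" "dense_subset (cyl_topology X) E" by auto
  have DX: "D \<subseteq> X" and EX: "E \<subseteq> X" using D(2) E(2) by (auto simp: dense_subset_cyl_topology)
  obtain A :: "nat \<Rightarrow> (nat \<Rightarrow> 'b) set" where A: "\<And>n. task D (A n)" "(\<Union>n. A n) = X" using task_cover[OF D] by blast
  obtain B :: "nat \<Rightarrow> (nat \<Rightarrow> 'b) set" where B: "\<And>n. task E (B n)" "(\<Union>n. B n) = X" using task_cover[OF E] by blast
  have op: "openin (cyl_topology X) X" by (simp add: openin_cyl_topology)
  have "\<exists>R. \<forall>n. partial_match X D E X X (R n) \<and>
    (R (Suc n) \<subseteq> R n \<and> (\<forall>x\<in>A n. \<exists>y. (x, y) \<in> R (Suc n) \<and> settled (R (Suc n)) x y) \<and>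
      (\<forall>y\<in>B n. \<exists>x. (x, y) \<in> R (Suc n) \<and> settled (R (Suc n)) x y))"
  proof (rule dependent_nat_choice)
    show "\<exists>R. partial_match X D E X X R"
      using partial_match_full[OF op op nonempty nonempty] by blast
    show "\<exists>R'. partial_match X D E X X R' \<and> (R' \<subseteq> R \<and>
        (\<forall>x\<in>A n. \<exists>y. (x, y) \<in> R' \<and> settled R' x y) \<and> (\<forall>y\<in>B n. \<exists>x. (x, y) \<in> R' \<and> settled R' x y))"
      if "partial_match X D E X X R" for R n
      using two_sided_step[OF D E that A(1)[of n] B(1)[of n]] by blast
  qed
  then obtain R where R: "\<And>n. partial_match X D E X X (R n)" "\<And>n. R (Suc n) \<subseteq> R n"
    "\<And>n x. x \<in> A n \<Longrightarrow> \<exists>y. (x, y) \<in> R (Suc n) \<and> settled (R (Suc n)) x y"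
    "\<And>n y. y \<in> B n \<Longrightarrow> \<exists>x. (x, y) \<in> R (Suc n) \<and> settled (R (Suc n)) x y" by blast
  have DE: "x \<in> D \<longleftrightarrow> y \<in> E" if "(x, y) \<in> R n" "settled (R n) x y" for x y n
  proof -
    \<comment> \<open>In a space without isolated points a box contains more than one value, hence no settled pair.\<close>
    have "\<not> boxed X (R n) x y"
    proof
      assume "boxed X (R n) x y"
      then obtain U V where UV: "x \<in> U" "y \<in> V" "openin (cyl_topology X) V" "U \<times> V \<subseteq> R n"
        unfolding boxed_def by blast
      then have "y \<in> X" by (auto simp: openin_cyl_topology)
      obtain k where "\<forall>v\<in>X. agree k y v \<longrightarrow> v \<in> V" using UV unfolding openin_cyl_topology by blast
      then obtain v where "v \<in> V" "v \<noteq> y" using crowded[OF \<open>y \<in> X\<close>, of k] by blast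
      then show False using UV settled_unique[OF that(2)] by blast
    qed
    then show ?thesis using R(1)[of n] that(1) unfolding partial_match_def by blast
  qed
  have "\<exists>n y. (x, y) \<in> R n \<and> settled (R n) x y \<and> (x \<in> D \<longleftrightarrow> y \<in> E)" if xX: "x \<in> X" for x
  proof -
    obtain n where "x \<in> A n" using xX A(2) by blast
    from R(3)[OF this] obtain y where "(x, y) \<in> R (Suc n)" "settled (R (Suc n)) x y" by meson
    then show ?thesis using DE by (intro exI[of _ "Suc n"] exI[of _ y]) simp
  qed
  from homeomorphism_of_matches[OF R(1,2) this] obtain h where
    h: "continuous_map (cyl_topology X) (cyl_topology X) h" "\<And>x. x \<in> X \<Longrightarrow> x \<in> D \<longleftrightarrow> h x \<in> E"
    "\<And>x y. x \<in> X \<Longrightarrow> (\<forall>n. (x, y) \<in> R n) \<longleftrightarrow> y = h x" by blast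
  have "\<exists>n x. (y, x) \<in> (R n)\<inverse> \<and> settled ((R n)\<inverse>) y x \<and> (y \<in> E \<longleftrightarrow> x \<in> D)" if yX: "y \<in> X" for y
  proof -
    obtain n where "y \<in> B n" using yX B(2) by blast
    from R(4)[OF this] obtain x where "(x, y) \<in> R (Suc n)" "settled (R (Suc n)) x y" by meson
    then show ?thesis using DE
      by (intro exI[of _ "Suc n"] exI[of _ x]) (auto simp: settled_converse)
  qed
  from homeomorphism_of_matches[of E D "\<lambda>n. (R n)\<inverse>", OF partial_match_converse[OF R(1)] _ this] R(2)
  obtain g where g: "continuous_map (cyl_topology X) (cyl_topology X) g"
    "\<And>x y. y \<in> X \<Longrightarrow> (\<forall>n. (x, y) \<in> R n) \<longleftrightarrow> x = g y" by auto
  have hX: "h x \<in> X" and gX: "g x \<in> X" if "x \<in> X" for x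
    using that h(1) g(1) by (auto simp: continuous_map_def)
  have gh: "g (h x) = x" if "x \<in> X" for x using h(3)[OF that] g(2)[OF hX[OF that]] by metis
  have hg: "h (g y) = y" if "y \<in> X" for y using g(2)[OF that] h(3)[OF gX[OF that]] by metis
  have "homeomorphic_map (cyl_topology X) (cyl_topology X) h"
    unfolding homeomorphic_map_maps homeomorphic_maps_def using h(1) g(1) gh hg by auto
  moreover have "h ` D = E"
  proof
    show "h ` D \<subseteq> E" using h(2) DX by blast
    show "E \<subseteq> h ` D"
    proof
      fix y assume "y \<in> E"
      then have "y = h (g y)" "g y \<in> D" using EX hg h(2)[OF gX] by (auto simp: subset_iff)
      then show "y \<in> h ` D" by blast
    qed
  qed
  ultimately show "\<exists>h. homeomorphic_map (cyl_topology X) (cyl_topology X) h \<and> h ` D = E" by blast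
qed

text \<open>A countable dense set is the union of its points, and its complement is a countable union of closed sets
that miss a dense set. So the whole space is meagre in itself.\<close>

lemma not_completely_metrizable: "\<not> completely_metrizable_space (cyl_topology X)"
proof
  assume cm: "completely_metrizable_space (cyl_topology X)"
  obtain D where D: "countable D" "dense_subset (cyl_topology X) D"
    using countable_dense_cyl_topology[of C X] countable_values by blast
  obtain A :: "nat \<Rightarrow> (nat \<Rightarrow> 'b) set" where A: "\<And>n. task D (A n)" "(\<Union>n. A n) = X"
    using task_cover[OF D] by blast
  have "cyl_topology X interior_of \<Union>(range A) = {}"
  proof (rule Baire_category_alt)
    fix B assume "B \<in> range A"
    then have B: "task D B" using A(1) by blast
    have "W = {}" if W: "openin (cyl_topology X) W" "W \<subseteq> B" for W
    proof (rule ccontr)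
      assume "W \<noteq> {}"
      then obtain x where x: "x \<in> W" by blast
      then have "x \<in> X" using W(1) by (auto simp: openin_cyl_topology)
      obtain n where n: "\<forall>y\<in>X. agree n x y \<longrightarrow> y \<in> W"
        using W(1) x unfolding openin_cyl_topology by blast
      obtain d where "d \<in> D" "agree n x d" "d \<in> X"
        using D(2) \<open>x \<in> X\<close> unfolding dense_subset_cyl_topology by blast
      then have "d \<in> B \<inter> D" using n W(2) by blast
      then obtain d' where "B = {d'}" using B unfolding task_def by blast
      then have "B = {x}" using x W(2) by blast
      then show False using crowded[OF \<open>x \<in> X\<close>, of n] n W(2) by blast
    qed
    then show "closedin (cyl_topology X) B \<and> cyl_topology X interior_of B = {}"
      using B unfolding task_def by (simp add: interior_of_eq_empty)
  qed (use cm in auto)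
  moreover have "cyl_topology X interior_of X = X"
    using interior_of_topspace[of "cyl_topology X"] by simp
  ultimately show False using A(2) nonempty by simp
qed

end

section \<open>An uncountable chain of fast growing functions\<close>

definition dominated :: "(nat \<Rightarrow> nat) \<Rightarrow> (nat \<Rightarrow> nat) \<Rightarrow> bool"
  where "dominated a b \<longleftrightarrow> (\<forall>N. \<forall>\<^sub>F k in sequentially. N * a k < b k)"

lemma dominated_trans:
  assumes "dominated a b" "dominated b c"
  shows "dominated a c"
  unfolding dominated_def
proof
  fix N
  have "\<forall>\<^sub>F k in sequentially. N * a k < b k" "\<forall>\<^sub>F k in sequentially. 1 * b k < c k"
    using assms unfolding dominated_def by blast+
  then show "\<forall>\<^sub>F k in sequentially. N * a k < c k" by eventually_elim simp
qed

lemma not_dominated_self: "\<not> dominated a a"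
proof
  assume "dominated a a"
  then have "\<forall>\<^sub>F k in sequentially. 1 * a k < a k" unfolding dominated_def by blast
  then show False by simp
qed

text \<open>Diagonalization: at argument \<open>k\<close>, the new function exceeds \<open>k\<close> times each of the functions with
number at most \<open>k\<close>.\<close>

lemma countable_dominated:
  assumes "countable A"
  shows "\<exists>g. (\<forall>k. 0 < g k) \<and> (\<forall>a\<in>A. dominated a g)"
proof (cases "A = {}")
  case True
  then show ?thesis by (intro exI[of _ "\<lambda>_. 1"]) simp
next
  case False
  define e where "e = from_nat_into A"
  define g where "g k = Suc (\<Sum>i\<le>k. k * e i k)" for k
  have "dominated (e i) g" for i
    unfolding dominated_def
  proof
    fix N
    have "N * e i k < g k" if "max N i \<le> k" for k
    proof -
      have "N * e i k \<le> k * e i k" using that by simp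
      also have "\<dots> \<le> (\<Sum>i\<le>k. k * e i k)" by (rule member_le_sum) (use that in auto)
      finally show ?thesis by (simp add: g_def)
    qed
    then show "\<forall>\<^sub>F k in sequentially. N * e i k < g k"
      unfolding eventually_sequentially by blast
  qed
  moreover have "\<exists>i. a = e i" if "a \<in> A" for a
    using from_nat_into_surj[OF assms that] unfolding e_def by metis
  ultimately show ?thesis by (intro exI[of _ g]) (auto simp: g_def)
qed

text \<open>The functions are chosen by recursion along the first uncountable cardinal, whose proper initial
segments are countable. Only the set of values is kept: domination itself recovers the order.\<close>

lemma omega1_chain:
  includes cardinal_syntax
  shows "\<exists>L :: (nat \<Rightarrow> nat) set. uncountable L \<and> (\<forall>a\<in>L. \<forall>k. 0 < a k) \<and>
    (\<forall>a\<in>L. countable {b \<in> L. dominated b a}) \<and>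
    (\<forall>a\<in>L. \<forall>b\<in>L. a = b \<or> dominated a b \<or> dominated b a)"
proof -
  define r where "r = cardSuc natLeq"
  have co: "Card_order r" unfolding r_def using natLeq_Card_order by (rule cardSuc_Card_order)
  have wo: "Well_order r" using co by (rule card_order_on_well_order_on)
  have cU: "countable (underS r a)" if "a \<in> Field r" for a
  proof -
    have "|underS r a| <o r" by (rule card_of_underS[OF co that])
    then have "|underS r a| \<le>o natLeq"
      unfolding r_def using cardSuc_ordLeq_ordLess[OF natLeq_Card_order card_of_Card_order] by blast
    then show ?thesis by (simp add: countable_card_le_natLeq)
  qed
  have unc: "uncountable (Field r)"
  proof
    assume "countable (Field r)"
    then have "|Field r| \<le>o natLeq" by (simp add: countable_card_le_natLeq)
    then have "r \<le>o natLeq" using card_of_Field_ordIso[OF co] ordIso_ordLeq_trans ordIso_symmetric by blast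
    moreover have "natLeq <o r" unfolding r_def using natLeq_Card_order by (rule cardSuc_greater)
    ultimately show False using not_ordLess_ordLeq by blast
  qed
  have wf: "wf (r - Id)" using wo by (simp add: well_order_on_def)
  have und: "underS r a = {b. (b, a) \<in> r - Id}" for a by (auto simp: underS_def)
  have "\<exists>f. \<forall>x. (x \<in> Field r \<longrightarrow> (\<forall>k. 0 < f x k) \<and> (\<forall>b\<in>underS r x. dominated (f b) (f x)))"
  proof (rule dependent_wf_choice[OF wf])
    show "(x \<in> Field r \<longrightarrow> (\<forall>k. 0 < g k) \<and> (\<forall>b\<in>underS r x. dominated (f b) g)) =
        (x \<in> Field r \<longrightarrow> (\<forall>k. 0 < g k) \<and> (\<forall>b\<in>underS r x. dominated (f' b) g))"
      if "\<And>z. (z, x) \<in> r - Id \<Longrightarrow> f z = f' z" for f f' :: "nat set \<Rightarrow> nat \<Rightarrow> nat" and x g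
      using that by (auto simp: und)
    show "\<exists>g. x \<in> Field r \<longrightarrow> (\<forall>k. 0 < g k) \<and> (\<forall>b\<in>underS r x. dominated (f b) g)"
      for f :: "nat set \<Rightarrow> nat \<Rightarrow> nat" and x
    proof (cases "x \<in> Field r")
      case True
      then have "countable (f ` underS r x)" using cU by simp
      from countable_dominated[OF this] show ?thesis by auto
    qed simp
  qed
  then obtain f where f: "\<And>x k. x \<in> Field r \<Longrightarrow> 0 < f x k"
    "\<And>x b. x \<in> Field r \<Longrightarrow> b \<in> underS r x \<Longrightarrow> dominated (f b) (f x)" by metis
  have total: "a = b \<or> a \<in> underS r b \<or> b \<in> underS r a" if "a \<in> Field r" "b \<in> Field r" for a b
    using wo that unfolding well_order_on_def linear_order_on_def total_on_def underS_def by blast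
  have inj: "inj_on f (Field r)"
  proof (rule inj_onI)
    fix a b assume ab: "a \<in> Field r" "b \<in> Field r" "f a = f b"
    then show "a = b" using total[OF ab(1,2)] f(2)[OF ab(1), of b] f(2)[OF ab(2), of a]
      not_dominated_self by auto
  qed
  define L where "L = f ` Field r"
  have "uncountable L" unfolding L_def using unc inj countable_image_inj_on by blast
  moreover have "\<forall>a\<in>L. \<forall>k. 0 < a k" using f(1) by (auto simp: L_def)
  moreover have "countable {b \<in> L. dominated b a}" if "a \<in> L" for a
  proof -
    obtain x where x: "x \<in> Field r" "a = f x" using \<open>a \<in> L\<close> by (auto simp: L_def)
    have "{b \<in> L. dominated b a} \<subseteq> f ` underS r x"
    proof
      fix b assume "b \<in> {b \<in> L. dominated b a}"
      then obtain y where y: "y \<in> Field r" "b = f y" "dominated (f y) (f x)"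
        using x by (auto simp: L_def)
      have "y \<noteq> x" using y(3) not_dominated_self by auto
      moreover have "x \<notin> underS r y"
        using f(2)[OF y(1), of x] dominated_trans[OF y(3)] not_dominated_self by blast
      ultimately show "b \<in> f ` underS r x" using total[OF x(1) y(1)] y(2) by blast
    qed
    then show ?thesis by (rule countable_subset) (simp add: cU[OF x(1)])
  qed
  moreover have "\<forall>a\<in>L. \<forall>b\<in>L. a = b \<or> dominated a b \<or> dominated b a"
  proof (intro ballI)
    fix a b assume "a \<in> L" "b \<in> L"
    then obtain x y where xy: "x \<in> Field r" "a = f x" "y \<in> Field r" "b = f y" by (auto simp: L_def)
    then show "a = b \<or> dominated a b \<or> dominated b a"
      using total[OF xy(1,3)] f(2)[OF xy(1), of y] f(2)[OF xy(3), of x] by auto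
  qed
  ultimately show ?thesis by (intro exI[of _ L]) simp
qed

section \<open>Growth of integer combinations\<close>

definition int_span :: "(nat \<Rightarrow> nat) set \<Rightarrow> (nat \<Rightarrow> real) set"
  where "int_span S = {h. \<exists>A c. finite A \<and> A \<subseteq> S \<and> h = (\<lambda>k. \<Sum>a\<in>A. real_of_int (c a) * real (a k))}"

lemma int_span_zero: "(\<lambda>_. 0) \<in> int_span S"
  unfolding int_span_def by (intro CollectI exI[of _ "{}"]) simp

lemma int_span_base: "a \<in> S \<Longrightarrow> (\<lambda>k. real (a k)) \<in> int_span S"
  unfolding int_span_def by (intro CollectI exI[of _ "{a}"] exI[of _ "\<lambda>_. 1"]) simp

lemma int_span_mono: "S \<subseteq> T \<Longrightarrow> int_span S \<subseteq> int_span T"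
  unfolding int_span_def by blast

lemma int_span_add:
  assumes "g \<in> int_span S" "h \<in> int_span S"
  shows "(\<lambda>k. g k + h k) \<in> int_span S"
proof -
  obtain A c where A: "finite A" "A \<subseteq> S" "g = (\<lambda>k. \<Sum>a\<in>A. real_of_int (c a) * real (a k))"
    using assms(1) unfolding int_span_def by blast
  obtain B d where B: "finite B" "B \<subseteq> S" "h = (\<lambda>k. \<Sum>a\<in>B. real_of_int (d a) * real (a k))"
    using assms(2) unfolding int_span_def by blast
  have ext: "(\<Sum>a\<in>A'. real_of_int (c' a) * real (a k)) =
      (\<Sum>a\<in>A\<union>B. real_of_int (if a \<in> A' then c' a else 0) * real (a k))"
    if "A' \<subseteq> A \<union> B" for A' c' k
    by (rule sum.mono_neutral_cong_left) (use A(1) B(1) that in auto)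
  have "g k + h k = (\<Sum>a\<in>A\<union>B. real_of_int ((if a \<in> A then c a else 0) + (if a \<in> B then d a else 0)) * real (a k))" for k
    unfolding A(3) B(3) ext[of A c k, OF Un_upper1] ext[of B d k, OF Un_upper2]
    by (simp only: of_int_add distrib_right sum.distrib)
  then show ?thesis
    unfolding int_span_def using A(1,2) B(1,2)
    by (intro CollectI exI[of _ "A \<union> B"] exI[of _ "\<lambda>a. (if a \<in> A then c a else 0) + (if a \<in> B then d a else 0)"]) auto
qed

lemma int_span_minus:
  assumes "g \<in> int_span S"
  shows "(\<lambda>k. - g k) \<in> int_span S"
proof -
  obtain A c where A: "finite A" "A \<subseteq> S" "g = (\<lambda>k. \<Sum>a\<in>A. real_of_int (c a) * real (a k))"
    using assms(1) unfolding int_span_def by blast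
  then show ?thesis
    unfolding int_span_def
    by (intro CollectI exI[of _ A] exI[of _ "\<lambda>a. - c a"]) (simp add: sum_negf)
qed

lemma int_span_Ints: "g \<in> int_span S \<Longrightarrow> g k \<in> \<int>"
  unfolding int_span_def by (auto intro!: Ints_sum Ints_mult)

lemma countable_int_span:
  assumes "countable S"
  shows "countable (int_span S)"
proof -
  define F where "F A = (\<lambda>c k. \<Sum>a\<in>A. real_of_int (c a) * real (a k)) ` (Pi\<^sub>E A (\<lambda>_. UNIV))" for A :: "(nat \<Rightarrow> nat) set"
  have "int_span S \<subseteq> (\<Union>A\<in>{A. A \<subseteq> S \<and> finite A}. F A)"
  proof
    fix h assume "h \<in> int_span S"
    then obtain A c where A: "finite A" "A \<subseteq> S" "h = (\<lambda>k. \<Sum>a\<in>A. real_of_int (c a) * real (a k))"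
      unfolding int_span_def by blast
    have "h = (\<lambda>k. \<Sum>a\<in>A. real_of_int (restrict c A a) * real (a k))"
      unfolding A(3) by (intro ext sum.cong) auto
    then have "h \<in> F A" unfolding F_def by (intro image_eqI[of _ _ "restrict c A"]) auto
    then show "h \<in> (\<Union>A\<in>{A. A \<subseteq> S \<and> finite A}. F A)" using A by blast
  qed
  moreover have "countable (\<Union>A\<in>{A. A \<subseteq> S \<and> finite A}. F A)"
  proof (rule countable_UN)
    show "countable {A. A \<subseteq> S \<and> finite A}"
      using countable_Collect_finite_subset[OF assms] by (simp add: conj_commute)
    show "countable (F A)" if "A \<in> {A. A \<subseteq> S \<and> finite A}" for A
      unfolding F_def using that by (intro countable_image countable_PiE) auto
  qed
  ultimately show ?thesis by (rule countable_subset)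
qed

text \<open>The induction needs all multipliers \<open>N\<close> simultaneously: doubling \<open>N\<close> gives each of the two summands
half of the available room.\<close>

lemma sum_dominated:
  assumes "finite A" "\<And>b. b \<in> A \<Longrightarrow> dominated b a" "\<And>k. 0 < a k"
  shows "\<forall>\<^sub>F k in sequentially. N * (\<Sum>b\<in>A. d b * b k) < a k"
  using assms(1,2)
proof (induction A arbitrary: N rule: finite_induct)
  case empty
  then show ?case using assms(3) by simp
next
  case (insert b A)
  have "\<forall>\<^sub>F k in sequentially. (2 * N) * (\<Sum>b\<in>A. d b * b k) < a k" using insert by simp
  moreover have "\<forall>\<^sub>F k in sequentially. (2 * N * d b) * b k < a k"
    using insert.prems[of b] unfolding dominated_def by blast
  ultimately show ?case
  proof eventually_elim
    case (elim k)
    have "2 * (N * (\<Sum>b\<in>insert b A. d b * b k)) = (2 * N) * (\<Sum>b\<in>A. d b * b k) + (2 * N * d b) * b k"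
      using insert.hyps by (simp add: algebra_simps)
    then show ?case using elim by linarith
  qed
qed

lemma combination_small:
  assumes "finite A" "\<And>b. b \<in> A \<Longrightarrow> dominated b a" "\<And>k. 0 < a k"
  shows "\<forall>\<^sub>F k in sequentially. 2 * \<bar>\<Sum>b\<in>A. real_of_int (c b) * real (b k)\<bar> < real (a k)"
proof -
  have "\<forall>\<^sub>F k in sequentially. 2 * (\<Sum>b\<in>A. nat \<bar>c b\<bar> * b k) < a k"
    by (rule sum_dominated) (use assms in auto)
  then show ?thesis
  proof eventually_elim
    case (elim k)
    have "\<bar>\<Sum>b\<in>A. real_of_int (c b) * real (b k)\<bar> \<le> (\<Sum>b\<in>A. \<bar>real_of_int (c b) * real (b k)\<bar>)"
      by (rule sum_abs)
    also have "\<dots> = real (\<Sum>b\<in>A. nat \<bar>c b\<bar> * b k)"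
      by (simp add: abs_mult)
    finally show ?case using elim by linarith
  qed
qed

text \<open>The two lemmas on growth together say that membership in the span of an initial segment
can be read off from the growth of \<open>h\<close>. The factor \<open>2\<close> leaves room for the lower order terms.\<close>

lemma not_eventually_large:
  assumes "h \<in> int_span {b \<in> L. dominated b a}" "\<And>k. 0 < a k"
  shows "\<not> (\<forall>\<^sub>F k in sequentially. real (a k) \<le> 2 * \<bar>h k\<bar>)"
proof
  assume 1: "\<forall>\<^sub>F k in sequentially. real (a k) \<le> 2 * \<bar>h k\<bar>"
  obtain A c where A: "finite A" "A \<subseteq> {b \<in> L. dominated b a}"
    "h = (\<lambda>k. \<Sum>a\<in>A. real_of_int (c a) * real (a k))"
    using assms(1) unfolding int_span_def by blast
  have "\<forall>\<^sub>F k in sequentially. 2 * \<bar>h k\<bar> < real (a k)"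
    unfolding A(3) by (rule combination_small) (use A assms(2) in auto)
  with 1 have "\<forall>\<^sub>F k in sequentially. False" by eventually_elim simp
  then show False by simp
qed

lemma finite_chain_top:
  assumes "finite A" "A \<noteq> {}" "\<And>a b. a \<in> A \<Longrightarrow> b \<in> A \<Longrightarrow> a = b \<or> dominated a b \<or> dominated b a"
  shows "\<exists>m\<in>A. \<forall>b\<in>A. b = m \<or> dominated b m"
  using assms
proof (induction A rule: finite_ne_induct)
  case (insert x A)
  then obtain m where m: "m \<in> A" "\<forall>b\<in>A. b = m \<or> dominated b m" by auto
  consider "x = m" | "dominated x m" | "dominated m x" using insert.prems[of x m] m(1) by blast
  then show ?case
  proof cases
    case 3
    then have "\<forall>b\<in>insert x A. b = x \<or> dominated b x" using m(2) dominated_trans[of _ m x] by auto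
    then show ?thesis by blast
  qed (use m in blast)+
qed auto

text \<open>The leading member \<open>m\<close> is \<open>a\<close> or above \<open>a\<close>, its integer coefficient has absolute value at least \<open>1\<close>, and
the other terms together are less than half of \<open>m\<close>.\<close>

lemma eventually_large:
  assumes chain: "\<And>a b. a \<in> L \<Longrightarrow> b \<in> L \<Longrightarrow> a = b \<or> dominated a b \<or> dominated b a"
    and pos: "\<And>a k. a \<in> L \<Longrightarrow> 0 < a k"
    and h: "h \<in> int_span L" "h \<notin> int_span {b \<in> L. dominated b a}" and a: "a \<in> L"
  shows "\<forall>\<^sub>F k in sequentially. real (a k) \<le> 2 * \<bar>h k\<bar>"
proof -
  obtain B c where B: "finite B" "B \<subseteq> L" "h = (\<lambda>k. \<Sum>a\<in>B. real_of_int (c a) * real (a k))"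
    using h(1) unfolding int_span_def by blast
  define A where "A = {b \<in> B. c b \<noteq> 0}"
  have A: "finite A" "A \<subseteq> L" using B by (auto simp: A_def)
  have hA: "h = (\<lambda>k. \<Sum>a\<in>A. real_of_int (c a) * real (a k))"
    unfolding B(3) A_def by (intro ext sum.mono_neutral_cong_right) (use B in auto)
  have "\<not> A \<subseteq> {b \<in> L. dominated b a}" using h(2) A(1) hA unfolding int_span_def by blast
  then obtain b where b: "b \<in> A" "\<not> dominated b a" using A(2) by blast
  obtain m where m: "m \<in> A" "\<forall>b\<in>A. b = m \<or> dominated b m"
    using finite_chain_top[OF A(1)] b(1) chain A(2) by blast
  have "a = b \<or> dominated a b" using chain[OF a] b A(2) by blast
  then have am: "a = m \<or> dominated a m" using m(2) b(1) dominated_trans[of a b m] by auto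
  have ev_am: "\<forall>\<^sub>F k in sequentially. a k \<le> m k"
  proof (cases "a = m")
    case False
    then have "\<forall>\<^sub>F k in sequentially. 1 * a k < m k" using am unfolding dominated_def by blast
    then show ?thesis by eventually_elim simp
  qed simp
  have "\<forall>\<^sub>F k in sequentially. 2 * \<bar>\<Sum>b\<in>A - {m}. real_of_int (c b) * real (b k)\<bar> < real (m k)"
    by (rule combination_small) (use A m pos in auto)
  with ev_am show ?thesis
  proof eventually_elim
    case (elim k)
    have "h k = real_of_int (c m) * real (m k) + (\<Sum>b\<in>A - {m}. real_of_int (c b) * real (b k))"
      unfolding hA using A(1) m(1) by (simp add: sum.remove)
    moreover have "real (m k) \<le> \<bar>real_of_int (c m) * real (m k)\<bar>"
    proof -
      have "c m \<noteq> 0" using m(1) by (simp add: A_def)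
      then have "1 \<le> \<bar>c m\<bar>" by linarith
      then have "1 \<le> \<bar>real_of_int (c m)\<bar>" by linarith
      then have "1 * real (m k) \<le> \<bar>real_of_int (c m)\<bar> * real (m k)" by (rule mult_right_mono) simp
      then show ?thesis by (simp add: abs_mult)
    qed
    ultimately show ?case using elim by linarith
  qed
qed

section \<open>Arrays with finitely many non-zero rows\<close>

definition row :: "(nat \<Rightarrow> 'b) \<Rightarrow> nat \<Rightarrow> nat \<Rightarrow> 'b"
  where "row x i = (\<lambda>j. x (prod_encode (i, j)))"

text \<open>The finiteness condition on the rows keeps \<open>arrays S\<close> countable for a countable \<open>S\<close>; arbitrary
sequences of rows would already be uncountable in number.\<close>

definition arrays :: "(nat \<Rightarrow> nat) set \<Rightarrow> (nat \<Rightarrow> real) set"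
  where "arrays S = {x. (\<forall>i. row x i \<in> int_span S) \<and> (\<exists>n. \<forall>i\<ge>n. row x i = (\<lambda>_. 0))}"

lemma rows_eqI:
  assumes "\<And>i. row x i = row y i"
  shows "x = y"
proof
  fix n
  have "row x (fst (prod_decode n)) (snd (prod_decode n)) = row y (fst (prod_decode n)) (snd (prod_decode n))"
    using assms by simp
  then show "x n = y n" by (simp add: row_def)
qed

lemma arrays_mono: "S \<subseteq> T \<Longrightarrow> arrays S \<subseteq> arrays T"
  using int_span_mono unfolding arrays_def by blast

lemma arrays_Ints:
  assumes "x \<in> arrays S"
  shows "x n \<in> \<int>"
proof -
  have "row x (fst (prod_decode n)) (snd (prod_decode n)) \<in> \<int>"
    using assms int_span_Ints unfolding arrays_def by blast
  then show ?thesis by (simp add: row_def)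
qed

lemma countable_arrays:
  assumes "countable S"
  shows "countable (arrays S)"
proof -
  define dec :: "(nat \<Rightarrow> real) list \<Rightarrow> nat \<Rightarrow> real"
    where "dec xs = (\<lambda>n. case prod_decode n of (i, j) \<Rightarrow> if i < length xs then (xs ! i) j else 0)" for xs
  have "arrays S \<subseteq> dec ` lists (int_span S)"
  proof
    fix x assume x: "x \<in> arrays S"
    then obtain n where n: "\<And>i. n \<le> i \<Longrightarrow> row x i = (\<lambda>_. 0)" unfolding arrays_def by blast
    have "row x i = row (dec (map (row x) [0..<n])) i" for i
      using n[of i] by (auto simp: row_def dec_def fun_eq_iff)
    then have "x = dec (map (row x) [0..<n])" by (rule rows_eqI)
    moreover have "map (row x) [0..<n] \<in> lists (int_span S)" using x by (auto simp: arrays_def)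
    ultimately show "x \<in> dec ` lists (int_span S)" by blast
  qed
  moreover have "countable (dec ` lists (int_span S))"
    using countable_int_span[OF assms] by (intro countable_image countable_lists)
  ultimately show ?thesis by (rule countable_subset)
qed

lemma arrays_countable_support:
  assumes "x \<in> arrays S"
  shows "\<exists>T\<subseteq>S. countable T \<and> x \<in> arrays T"
proof -
  have "\<exists>A. finite A \<and> A \<subseteq> S \<and> row x i \<in> int_span A" for i
  proof -
    have "row x i \<in> int_span S" using assms by (simp add: arrays_def)
    then obtain A c where "finite A" "A \<subseteq> S" "row x i = (\<lambda>k. \<Sum>a\<in>A. real_of_int (c a) * real (a k))"
      unfolding int_span_def by blast
    moreover from this have "row x i \<in> int_span A" unfolding int_span_def by blast
    ultimately show ?thesis by blast
  qed
  then obtain A where A: "\<And>i. finite (A i)" "\<And>i. A i \<subseteq> S" "\<And>i. row x i \<in> int_span (A i)" by metis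
  have "row x i \<in> int_span (\<Union>i. A i)" for i
    using A(3)[of i] int_span_mono[of "A i" "\<Union>i. A i"] by blast
  then have "x \<in> arrays (\<Union>i. A i)" using assms by (simp add: arrays_def)
  moreover have "countable (\<Union>i. A i)" using A(1) by (simp add: countable_finite)
  ultimately show ?thesis using A(2) by (intro exI[of _ "\<Union>i. A i"]) blast
qed

definition splice :: "(nat \<Rightarrow> 'b) \<Rightarrow> nat \<Rightarrow> (nat \<Rightarrow> 'b) \<Rightarrow> (nat \<Rightarrow> 'b) \<Rightarrow> nat \<Rightarrow> 'b"
  where "splice x m t y = (\<lambda>n. case prod_decode n of (i, j) \<Rightarrow>
    if i < m then x n else if i = m then t j else y (prod_encode (i - Suc m, j)))"

lemma row_splice:
  "row (splice x m t y) i = (if i < m then row x i else if i = m then t else row y (i - Suc m))"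
  by (auto simp: row_def splice_def)

lemma prod_encode_mono1: "i \<le> i' \<Longrightarrow> prod_encode (i, j) \<le> prod_encode (i', j)"
  by (auto simp: prod_encode_def triangle_def intro!: add_mono div_le_mono mult_le_mono)

text \<open>Moving \<open>y\<close> to later rows only increases the positions of its coordinates.\<close>

lemma agree_splice:
  assumes "agree k y y'"
  shows "agree k (splice x m t y) (splice x m t y')"
  unfolding agree_def
proof (intro allI impI)
  fix n assume n: "n < k"
  obtain i j where ij: "prod_decode n = (i, j)" by fastforce
  then have n_eq: "n = prod_encode (i, j)" by (metis prod_decode_inverse)
  have "prod_encode (i - Suc m, j) \<le> n" unfolding n_eq by (rule prod_encode_mono1) simp
  then show "splice x m t y n = splice x m t y' n"
    using assms n by (simp add: splice_def ij agree_def)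
qed

definition unsplice :: "nat \<Rightarrow> (nat \<Rightarrow> 'b) \<Rightarrow> nat \<Rightarrow> 'b"
  where "unsplice m z = (\<lambda>n. z (prod_encode (fst (prod_decode n) + Suc m, snd (prod_decode n))))"

lemma row_unsplice: "row (unsplice m z) i = row z (i + Suc m)"
  by (simp add: unsplice_def row_def)

lemma unsplice_splice: "unsplice m (splice x m t y) = y"
  by (auto simp: unsplice_def splice_def fun_eq_iff)

lemma agree_unsplice: "\<exists>k. \<forall>z z'. agree k z z' \<longrightarrow> agree l (unsplice m z) (unsplice m z')"
proof -
  define g where "g n = prod_encode (fst (prod_decode n) + Suc m, snd (prod_decode n))" for n
  have "finite (g ` {..<l})" by simp
  then obtain k where "\<And>n. n < l \<Longrightarrow> g n < k" by (metis finite_nat_set_iff_bounded imageI lessThan_iff)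
  then show ?thesis unfolding agree_def unsplice_def g_def by (intro exI[of _ k]) blast
qed

locale omega1_scale =
  fixes L :: "(nat \<Rightarrow> nat) set"
  assumes uncountable: "uncountable L"
    and positive: "a \<in> L \<Longrightarrow> 0 < a k"
    and countable_below: "a \<in> L \<Longrightarrow> countable {b \<in> L. dominated b a}"
    and linear: "a \<in> L \<Longrightarrow> b \<in> L \<Longrightarrow> a = b \<or> dominated a b \<or> dominated b a"
begin

lemma countable_bounded:
  assumes "countable T" "T \<subseteq> L"
  shows "\<exists>a\<in>L. \<forall>t\<in>T. dominated t a"
proof -
  define B where "B = T \<union> (\<Union>t\<in>T. {b \<in> L. dominated b t})"
  have "countable B"
    unfolding B_def using assms countable_below by (intro countable_Un countable_UN) auto
  then have "\<not> L \<subseteq> B" using uncountable countable_subset[of L B] by blast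
  then obtain a where a: "a \<in> L" "a \<notin> B" by blast
  then have "dominated t a" if "t \<in> T" for t
    using linear[of a t] assms(2) that a unfolding B_def by auto
  then show ?thesis using a(1) by blast
qed

lemma uncountable_int_span: "uncountable (int_span L)"
proof
  assume "countable (int_span L)"
  moreover have "(\<lambda>a k. real (a k)) ` L \<subseteq> int_span L" using int_span_base by blast
  ultimately have "countable ((\<lambda>a k. real (a k)) ` L)" using countable_subset by blast
  moreover have "inj_on (\<lambda>a k. real (a k)) L" by (auto intro!: inj_onI simp: fun_eq_iff)
  ultimately show False using uncountable countable_image_inj_on by blast
qed

text \<open>With \<open>a\<close> above all chain members used by \<open>D\<close>, the sets \<open>B (i, m)\<close> state that row \<open>i\<close> grows at least
like \<open>a\<close> from position \<open>m\<close> on. They cover precisely the arrays that are not built from members below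
\<open>a\<close>; what remains of the complement of \<open>D\<close> is countable.\<close>

lemma arrays_co_F_sigma:
  assumes D: "countable D" "D \<subseteq> arrays L"
  shows "\<exists>\<A>. countable \<A> \<and> (\<forall>A\<in>\<A>. closedin (cyl_topology (arrays L)) A) \<and> \<Union>\<A> = arrays L - D"
proof -
  let ?X = "arrays L"
  have "\<forall>x\<in>D. \<exists>T\<subseteq>L. countable T \<and> x \<in> arrays T" using arrays_countable_support D(2) by blast
  then obtain T where T: "\<And>x. x \<in> D \<Longrightarrow> T x \<subseteq> L \<and> countable (T x) \<and> x \<in> arrays (T x)" by metis
  have "countable (\<Union>x\<in>D. T x)" "(\<Union>x\<in>D. T x) \<subseteq> L" using T D(1) by auto
  then obtain a where a: "a \<in> L" "\<forall>t\<in>(\<Union>x\<in>D. T x). dominated t a" using countable_bounded by meson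
  define P where "P = {b \<in> L. dominated b a}"
  have DP: "D \<subseteq> arrays P"
  proof
    fix x assume x: "x \<in> D"
    then have "T x \<subseteq> P" using T a(2) unfolding P_def by blast
    then show "x \<in> arrays P" using T[OF x] arrays_mono by blast
  qed
  have cP: "countable (arrays P)" unfolding P_def by (intro countable_arrays countable_below a(1))
  define B where "B = (\<lambda>(i, m). {x \<in> ?X. \<forall>k\<ge>m. real (a k) \<le> 2 * \<bar>row x i k\<bar>})"
  define \<A> where "\<A> = (\<lambda>x. {x}) ` (?X \<inter> arrays P - D) \<union> range B"
  have large: "x \<in> (\<Union>p. B p) \<longleftrightarrow> x \<notin> arrays P" if x: "x \<in> ?X" for x
  proof
    assume "x \<in> (\<Union>p. B p)"
    then obtain i m where "\<forall>k\<ge>m. real (a k) \<le> 2 * \<bar>row x i k\<bar>" by (auto simp: B_def)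
    then have "\<forall>\<^sub>F k in sequentially. real (a k) \<le> 2 * \<bar>row x i k\<bar>"
      unfolding eventually_sequentially by blast
    then have "row x i \<notin> int_span P"
      unfolding P_def using not_eventually_large[of "row x i" L a] positive[OF a(1)] by blast
    then show "x \<notin> arrays P" by (auto simp: arrays_def)
  next
    assume "x \<notin> arrays P"
    then obtain i where i: "row x i \<notin> int_span P" using x unfolding arrays_def by blast
    have "row x i \<in> int_span L" using x by (simp add: arrays_def)
    then have "\<forall>\<^sub>F k in sequentially. real (a k) \<le> 2 * \<bar>row x i k\<bar>"
      by (intro eventually_large[of L] linear positive a(1)) (use i in \<open>simp_all add: P_def\<close>)
    then obtain m where "\<forall>k\<ge>m. real (a k) \<le> 2 * \<bar>row x i k\<bar>"
      unfolding eventually_sequentially by blast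
    then have "x \<in> B (i, m)" using x by (simp add: B_def)
    then show "x \<in> (\<Union>p. B p)" by blast
  qed
  have "countable \<A>" unfolding \<A>_def using cP by (intro countable_Un countable_image) auto
  moreover have "closedin (cyl_topology ?X) A" if A: "A \<in> \<A>" for A
  proof (cases "A \<in> range B")
    case True
    then obtain i m where A: "A = {x \<in> ?X. \<forall>k\<ge>m. real (a k) \<le> 2 * \<bar>row x i k\<bar>}"
      by (auto simp: B_def)
    show ?thesis
      unfolding closedin_cyl_topology
    proof (intro conjI ballI impI)
      fix x assume x: "x \<in> ?X" and lim: "\<forall>n. \<exists>y\<in>A. agree n x y"
      have "real (a k) \<le> 2 * \<bar>row x i k\<bar>" if k: "k \<ge> m" for k
      proof -
        obtain y where y: "y \<in> A" "agree (Suc (prod_encode (i, k))) x y" using lim by blast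
        then have "row x i k = row y i k" by (simp add: agree_def row_def)
        moreover have "real (a k) \<le> 2 * \<bar>row y i k\<bar>" using y(1) k by (simp add: A)
        ultimately show ?thesis by simp
      qed
      then show "x \<in> A" using x by (simp add: A)
    qed (simp add: A)
  next
    case False
    then obtain x where x: "x \<in> ?X" "A = {x}" using A by (auto simp: \<A>_def)
    show ?thesis unfolding x(2) by (rule closedin_singleton[OF x(1)])
  qed
  moreover have "\<Union>\<A> = ?X - D"
  proof -
    have "\<Union>\<A> = (?X \<inter> arrays P - D) \<union> (\<Union>p. B p)" by (auto simp: \<A>_def)
    moreover have "(\<Union>p. B p) = ?X - arrays P"
    proof (rule Set.set_eqI)
      fix x
      have "x \<in> (\<Union>p. B p) \<Longrightarrow> x \<in> ?X" by (auto simp: B_def)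
      then show "x \<in> (\<Union>p. B p) \<longleftrightarrow> x \<in> ?X - arrays P" using large[of x] by (meson Diff_iff)
    qed
    ultimately show ?thesis using DP by auto
  qed
  ultimately show ?thesis by blast
qed

text \<open>The copy is \<open>splice x m t\<close>: its elements agree with \<open>x \<in> V\<close> on the first \<open>m\<close> coordinates, because a
coordinate below \<open>m\<close> lies in a row below \<open>m\<close>, and their row \<open>m\<close> is a row \<open>t\<close> that occurs in no
element of \<open>E\<close> at this place.\<close>

lemma arrays_absorb:
  assumes V: "openin (cyl_topology (arrays L)) V" "V \<noteq> {}" and E: "countable E"
  shows "\<exists>e. e ` arrays L \<subseteq> V - E \<and>
    (\<forall>A. closedin (cyl_topology (arrays L)) A \<longrightarrow> closedin (cyl_topology (arrays L)) (e ` A)) \<and>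
    (\<forall>x\<in>arrays L. settled {(x, e x) | x. x \<in> arrays L} x (e x))"
proof -
  let ?X = "arrays L"
  obtain x where x: "x \<in> V" using V(2) by blast
  have xX: "x \<in> ?X" using x V(1) by (auto simp: openin_cyl_topology)
  obtain m where m: "\<forall>y\<in>?X. agree m x y \<longrightarrow> y \<in> V" using x V(1) unfolding openin_cyl_topology by blast
  have "countable ((\<lambda>z. row z m) ` E)" using E by simp
  then have "\<not> int_span L \<subseteq> (\<lambda>z. row z m) ` E"
    using uncountable_int_span countable_subset[of "int_span L"] by blast
  then obtain t where t: "t \<in> int_span L" "t \<notin> (\<lambda>z. row z m) ` E" by blast
  define e where "e = splice x m t"
  define d :: "(nat \<Rightarrow> real) \<Rightarrow> nat \<Rightarrow> real" where "d = unsplice m"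
  have de: "d (e y) = y" for y unfolding d_def e_def by (rule unsplice_splice)
  have row_e: "row (e y) i = (if i < m then row x i else if i = m then t else row y (i - Suc m))" for y i
    unfolding e_def by (rule row_splice)
  have row_d: "row (d z) i = row z (i + Suc m)" for z i by (simp add: d_def row_unsplice)
  have eX: "e y \<in> ?X" if "y \<in> ?X" for y
  proof -
    obtain n where n: "\<And>i. n \<le> i \<Longrightarrow> row y i = (\<lambda>_. 0)" using \<open>y \<in> ?X\<close> unfolding arrays_def by blast
    have "row (e y) i = (\<lambda>_. 0)" if "Suc m + n \<le> i" for i
      unfolding row_e using that n[of "i - Suc m"] by simp
    moreover have "row (e y) i \<in> int_span L" for i
      using xX that t(1) by (simp add: row_e arrays_def)
    ultimately show ?thesis unfolding arrays_def by blast
  qed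
  have dX: "d z \<in> ?X" if "z \<in> ?X" for z
  proof -
    obtain n where n: "\<And>i. n \<le> i \<Longrightarrow> row z i = (\<lambda>_. 0)" using \<open>z \<in> ?X\<close> unfolding arrays_def by blast
    have "row (d z) i = (\<lambda>_. 0)" if "n \<le> i" for i
      unfolding row_d using that n[of "i + Suc m"] by simp
    moreover have "row (d z) i \<in> int_span L" for i
      using that by (simp add: row_d arrays_def)
    ultimately show ?thesis unfolding arrays_def by blast
  qed
  have e_cont: "agree k (e y) (e y')" if "agree k y y'" for k y y'
    unfolding e_def using that by (rule agree_splice)
  have d_cont: "\<exists>k. \<forall>z z'. agree k z z' \<longrightarrow> agree l (d z) (d z')" for l
    unfolding d_def by (rule agree_unsplice)
  have "e y \<in> V - E" if "y \<in> ?X" for y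
  proof -
    have "x n = e y n" if n: "n < m" for n
    proof -
      obtain i j where ij: "prod_decode n = (i, j)" by fastforce
      then have n_eq: "n = prod_encode (i, j)" by (metis prod_decode_inverse)
      have "i < m" using n le_prod_encode_1[of i j] unfolding n_eq by linarith
      then show ?thesis by (simp add: e_def splice_def ij)
    qed
    then have "agree m x (e y)" by (simp add: agree_def)
    then have "e y \<in> V" using m eX[OF that] by blast
    moreover have "row (e y) m = t" by (simp add: row_e)
    then have "e y \<notin> E" using t(2) by blast
    ultimately show ?thesis by blast
  qed
  moreover have "closedin (cyl_topology ?X) (e ` A)" if A: "closedin (cyl_topology ?X) A" for A
    unfolding closedin_cyl_topology
  proof (intro conjI ballI impI)
    have AX: "A \<subseteq> ?X" using A by (simp add: closedin_cyl_topology)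
    then show "e ` A \<subseteq> ?X" using eX by blast
    fix z assume z: "z \<in> ?X" and lim: "\<forall>n. \<exists>y\<in>e ` A. agree n z y"
    have "\<exists>y\<in>A. agree n (d z) y" for n
    proof -
      obtain k where k: "\<forall>z z'. agree k z z' \<longrightarrow> agree n (d z) (d z')" using d_cont by blast
      obtain y where "y \<in> A" "agree k z (e y)" using lim by blast
      then show ?thesis using k de by metis
    qed
    then have dA: "d z \<in> A" using A dX[OF z] unfolding closedin_cyl_topology by blast
    have "agree n z (e (d z))" for n
    proof -
      obtain k where k: "\<forall>z z'. agree k z z' \<longrightarrow> agree n (d z) (d z')" using d_cont by blast
      obtain y where y: "y \<in> A" "agree (max n k) z (e y)" using lim by blast
      have "agree k z (e y)" by (rule agree_mono[OF y(2)]) simp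
      then have "agree n (d z) y" using k de by metis
      then have "agree n (e (d z)) (e y)" by (rule e_cont)
      moreover have "agree n z (e y)" by (rule agree_mono[OF y(2)]) simp
      ultimately show ?thesis using agree_sym agree_trans by blast
    qed
    then have "z = e (d z)" by (rule agree_eqI)
    then show "z \<in> e ` A" using dA by blast
  qed
  moreover have "settled {(x, e x) | x. x \<in> ?X} y (e y)" for y
    unfolding settled_def usc_def
  proof (intro conjI allI)
    fix l
    show "\<exists>k. \<forall>u v. (u, v) \<in> {(x, e x) | x. x \<in> ?X} \<longrightarrow> agree k y u \<longrightarrow> agree l (e y) v"
      using e_cont by (intro exI[of _ l]) blast
    obtain k where k: "\<forall>z z'. agree k z z' \<longrightarrow> agree l (d z) (d z')" using d_cont by blast
    have "agree l y v" if "(u, v) \<in> {(x, e x) | x. x \<in> ?X}\<inverse>" "agree k (e y) u" for u v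
    proof -
      have "u = e v" using that(1) by blast
      then show ?thesis using k that(2) de by metis
    qed
    then show "\<exists>k. \<forall>u v. (u, v) \<in> {(x, e x) | x. x \<in> ?X}\<inverse> \<longrightarrow> agree k (e y) u \<longrightarrow> agree l y v"
      by blast
  qed
  ultimately show ?thesis by (intro exI[of _ e]) blast
qed

sublocale self_absorbing "arrays L" "\<int>"
proof
  have "(\<lambda>_. 0) \<in> arrays L" using int_span_zero by (simp add: arrays_def row_def)
  then show "arrays L \<noteq> {}" by blast
  show "countable (\<int> :: real set)" by (simp add: Ints_def)
qed (fact arrays_Ints arrays_co_F_sigma arrays_absorb)+

section \<open>The group\<close>

definition array_group :: "(nat \<Rightarrow> real) monoid"
  where "array_group = \<lparr>carrier = arrays L, mult = (\<lambda>x y n. x n + y n), one = (\<lambda>_. 0)\<rparr>"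

lemma arrays_add: "x \<in> arrays L \<Longrightarrow> y \<in> arrays L \<Longrightarrow> (\<lambda>n. x n + y n) \<in> arrays L"
proof -
  assume xy: "x \<in> arrays L" "y \<in> arrays L"
  then obtain m n where mn: "\<And>i. m \<le> i \<Longrightarrow> row x i = (\<lambda>_. 0)" "\<And>i. n \<le> i \<Longrightarrow> row y i = (\<lambda>_. 0)"
    unfolding arrays_def by blast
  have row: "row (\<lambda>n. x n + y n) i = (\<lambda>k. row x i k + row y i k)" for i by (simp add: row_def)
  have "row (\<lambda>n. x n + y n) i = (\<lambda>_. 0)" if "max m n \<le> i" for i
    unfolding row using mn that by simp
  moreover have "row (\<lambda>n. x n + y n) i \<in> int_span L" for i
    unfolding row by (rule int_span_add) (use xy in \<open>simp_all add: arrays_def\<close>)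
  ultimately show ?thesis unfolding arrays_def by blast
qed

lemma arrays_minus: "x \<in> arrays L \<Longrightarrow> (\<lambda>n. - x n) \<in> arrays L"
proof -
  assume x: "x \<in> arrays L"
  then obtain m where m: "\<And>i. m \<le> i \<Longrightarrow> row x i = (\<lambda>_. 0)" unfolding arrays_def by blast
  have row: "row (\<lambda>n. - x n) i = (\<lambda>k. - row x i k)" for i by (simp add: row_def)
  have "row (\<lambda>n. - x n) i = (\<lambda>_. 0)" if "m \<le> i" for i
    unfolding row using m that by simp
  moreover have "row (\<lambda>n. - x n) i \<in> int_span L" for i
    unfolding row by (rule int_span_minus) (use x in \<open>simp_all add: arrays_def\<close>)
  ultimately show ?thesis unfolding arrays_def by blast
qed

lemma group_array_group: "group array_group"
proof (rule groupI)
  show "\<one>\<^bsub>array_group\<^esub> \<in> carrier array_group"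
    using int_span_zero by (simp add: array_group_def arrays_def row_def)
  show "\<exists>y\<in>carrier array_group. y \<otimes>\<^bsub>array_group\<^esub> x = \<one>\<^bsub>array_group\<^esub>" if "x \<in> carrier array_group" for x
    using that arrays_minus[of x]
    by (intro bexI[of _ "\<lambda>n. - x n"]) (simp_all add: array_group_def)
qed (simp_all add: array_group_def arrays_add add.assoc)

lemma inv_array_group: "x \<in> arrays L \<Longrightarrow> inv\<^bsub>array_group\<^esub> x = (\<lambda>n. - x n)"
  using arrays_minus[of x]
  by (intro group.inv_equality[OF group_array_group]) (simp_all add: array_group_def)

lemma topological_group_array_group: "topological_group array_group (cyl_topology (arrays L))"
  unfolding topological_group_def
proof (intro conjI)
  let ?T = "cyl_topology (arrays L)"
  show "group array_group" by (rule group_array_group)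
  show "topspace ?T = carrier array_group" by (simp add: array_group_def)
  have "continuous_map (prod_topology ?T ?T) ?T (\<lambda>(x, y) n. x n + y n)"
    unfolding continuous_map_def
  proof (intro conjI allI impI)
    show "(\<lambda>(x, y) n. x n + y n) \<in> topspace (prod_topology ?T ?T) \<rightarrow> topspace ?T"
      using arrays_add by auto
    fix W assume W: "openin ?T W"
    show "openin (prod_topology ?T ?T) {p \<in> topspace (prod_topology ?T ?T). (case p of (x, y) \<Rightarrow> \<lambda>n. x n + y n) \<in> W}"
      unfolding openin_prod_topology_alt
    proof (intro allI impI)
      fix x y assume "(x, y) \<in> {p \<in> topspace (prod_topology ?T ?T). (case p of (x, y) \<Rightarrow> \<lambda>n. x n + y n) \<in> W}"
      then have xy: "x \<in> arrays L" "y \<in> arrays L" "(\<lambda>n. x n + y n) \<in> W" by auto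
      obtain k where k: "\<forall>z\<in>arrays L. agree k (\<lambda>n. x n + y n) z \<longrightarrow> z \<in> W"
        using W xy(3) unfolding openin_cyl_topology by blast
      have "(\<lambda>n. u n + v n) \<in> W" if "u \<in> arrays L" "v \<in> arrays L" "agree k x u" "agree k y v" for u v
        using k arrays_add[OF that(1,2)] that(3,4) by (simp add: agree_def)
      then show "\<exists>U V. openin ?T U \<and> openin ?T V \<and> x \<in> U \<and> y \<in> V \<and>
          U \<times> V \<subseteq> {p \<in> topspace (prod_topology ?T ?T). (case p of (x, y) \<Rightarrow> \<lambda>n. x n + y n) \<in> W}"
        using xy openin_cylinder
        by (intro exI[of _ "{u \<in> arrays L. agree k x u}"] exI[of _ "{v \<in> arrays L. agree k y v}"]) auto
    qed
  qed
  then show "continuous_map (prod_topology ?T ?T) ?T (\<lambda>(x, y). x \<otimes>\<^bsub>array_group\<^esub> y)"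
    by (simp add: array_group_def)
  have "continuous_map ?T ?T (\<lambda>x n. - x n)"
    unfolding continuous_map_def
  proof (intro conjI allI impI)
    show "(\<lambda>x n. - x n) \<in> topspace ?T \<rightarrow> topspace ?T" using arrays_minus by auto
    fix W assume W: "openin ?T W"
    show "openin ?T {x \<in> topspace ?T. (\<lambda>n. - x n) \<in> W}"
      unfolding openin_cyl_topology topspace_cyl_topology
    proof (intro conjI ballI)
      fix x assume "x \<in> {x \<in> arrays L. (\<lambda>n. - x n) \<in> W}"
      then obtain k where k: "\<forall>z\<in>arrays L. agree k (\<lambda>n. - x n) z \<longrightarrow> z \<in> W"
        using W unfolding openin_cyl_topology by blast
      have "\<forall>y\<in>arrays L. agree k x y \<longrightarrow> y \<in> {x \<in> arrays L. (\<lambda>n. - x n) \<in> W}"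
        using k arrays_minus by (auto simp: agree_def)
      then show "\<exists>n. \<forall>y\<in>arrays L. agree n x y \<longrightarrow> y \<in> {x \<in> arrays L. (\<lambda>n. - x n) \<in> W}" by blast
    qed simp
  qed
  then show "continuous_map ?T ?T (\<lambda>x. inv\<^bsub>array_group\<^esub> x)"
    by (rule continuous_map_eq) (simp add: inv_array_group)
qed

lemma separable_arrays: "separable_space (cyl_topology (arrays L))"
proof -
  obtain D where "countable D" "dense_subset (cyl_topology (arrays L)) D"
    using countable_dense_cyl_topology[of \<int> "arrays L"] countable_values by blast
  then show ?thesis unfolding separable_space_def dense_subset_def by blast
qed

end

theorem corollary3p4:
  shows "\<exists>(G :: (nat \<Rightarrow> real) monoid) (T :: (nat \<Rightarrow> real) topology).
    topological_group G T \<and> separable_space T \<and> metrizable_space T \<and>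
    countable_dense_homogeneous T \<and> \<not> Polish_space T"
proof -
  obtain L :: "(nat \<Rightarrow> nat) set" where "uncountable L" "\<forall>a\<in>L. \<forall>k. 0 < a k"
    "\<forall>a\<in>L. countable {b \<in> L. dominated b a}" "\<forall>a\<in>L. \<forall>b\<in>L. a = b \<or> dominated a b \<or> dominated b a"
    using omega1_chain by (elim exE conjE)
  then interpret omega1_scale L by unfold_locales auto
  show ?thesis
    using topological_group_array_group separable_arrays metrizable_space_cyl_topology[of "arrays L"]
      countable_dense_homogeneous_cyl not_completely_metrizable
    unfolding Polish_space_def
    by (intro exI[of _ array_group] exI[of _ "cyl_topology (arrays L)"]) simp
qed

end
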